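(* Let $G$ be a graph on $n$ vertices with at least one edge and at least one missing edge (i.e. $G$ is neither edge-empty nor complete). Let $\omega$, $\alpha$ and $h$ denote the order of a largest complete subgraph of $G$, the size of a largest independent set of $G$, and the Hadwiger number of $G$, respectively. Then $$(2\alpha - 1)\cdot (h-1) + 3 \geq n + \omega,$$ where equality is obtained if and only if at least one of the following holds: (i) $G$ is a non-empty forest with a perfect matching; or (ii) $G$ contains two (vertex-)disjoint complete subgraphs $K_{n/2}$, possibly with some edges between them, such that $h = n/2$.
   Context: All graphs are finite and simple. The Hadwiger number $h(G)$ of a graph $G$ is the maximum $k$ such that $G$ has the complete graph $K_k$ as a minor. $K_m$ denotes the complete graph on $m$ vertices. A forest is a graph without cycles. In (ii), $n$ is even, and the two disjoint copies of $K_{n/2}$ together cover all $n$ vertices of $G$. *)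

theory Defs
  imports "Graph_Theory.Graph_Theory"
begin

text \<open>
  Finite simple graphs are the \<^locale>\<open>graph\<close>s of the library: finite, loop-free, symmetric
  digraphs without parallel arcs. An undirected edge \<open>uv\<close> is the pair of opposite arcs
  from \<open>u\<close> to \<open>v\<close> and from \<open>v\<close> to \<open>u\<close>.
\<close>

definition uedges :: "('a, 'b) pre_digraph \<Rightarrow> 'a set set" where
  "uedges G = {{u, v} |u v. u \<rightarrow>\<^bsub>G\<^esub> v}"

definition clique_number :: "('a, 'b) pre_digraph \<Rightarrow> nat" where
  "clique_number G = Max {k. \<exists>H. subgraph H G \<and> K\<^bsub>k\<^esub> H}"

definition independent_set :: "('a, 'b) pre_digraph \<Rightarrow> 'a set \<Rightarrow> bool" where
  "independent_set G S \<longleftrightarrow> S \<subseteq> verts G \<and> (\<forall>u\<in>S. \<forall>v\<in>S. \<not> u \<rightarrow>\<^bsub>G\<^esub> v)"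

definition independence_number :: "('a, 'b) pre_digraph \<Rightarrow> nat" where
  "independence_number G = Max {card S |S. independent_set G S}"

text \<open>
  \<open>H\<close> is a minor of \<open>G\<close> if there are pairwise disjoint connected branch sets \<open>B x\<close> in \<open>G\<close>,
  one for each vertex \<open>x\<close> of \<open>H\<close>, with an edge of \<open>G\<close> between \<open>B x\<close> and \<open>B y\<close> whenever \<open>xy\<close> is
  an edge of \<open>H\<close>; contracting the branch sets and deleting the rest yields \<open>H\<close>. Branch sets are
  nonempty because \<^const>\<open>Digraph_Component.connected\<close> excludes the null graph.
\<close>

definition is_minor :: "('c, 'd) pre_digraph \<Rightarrow> ('a, 'b) pre_digraph \<Rightarrow> bool" where
  "is_minor H G \<longleftrightarrow> (\<exists>B :: 'c \<Rightarrow> 'a set.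
     (\<forall>x\<in>verts H. B x \<subseteq> verts G \<and> Digraph_Component.connected (G \<restriction> B x)) \<and>
     (\<forall>x\<in>verts H. \<forall>y\<in>verts H. x \<noteq> y \<longrightarrow> B x \<inter> B y = {}) \<and>
     (\<forall>x y. x \<rightarrow>\<^bsub>H\<^esub> y \<longrightarrow> (\<exists>u\<in>B x. \<exists>v\<in>B y. u \<rightarrow>\<^bsub>G\<^esub> v)))"

definition hadwiger_number :: "('a, 'b) pre_digraph \<Rightarrow> nat" where
  "hadwiger_number G =
     Max {k. \<exists>H :: (nat, nat \<times> nat) pre_digraph. K\<^bsub>k\<^esub> H \<and> is_minor H G}"

text \<open>
  In a symmetric digraph every edge gives rise to directed cycles \<open>u, v, u\<close> of length 2, so the
  library's \<^const>\<open>forest\<close> does not express acyclicity of the undirected graph. The cycles of the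
  undirected graph are the directed cycles of length at least 3.
\<close>

definition undirected_forest :: "('a, 'b) pre_digraph \<Rightarrow> bool" where
  "undirected_forest G \<longleftrightarrow> \<not> (\<exists>p. pre_digraph.cycle G p \<and> 3 \<le> length p)"

definition perfect_matching :: "('a, 'b) pre_digraph \<Rightarrow> 'a set set \<Rightarrow> bool" where
  "perfect_matching G M \<longleftrightarrow> M \<subseteq> uedges G \<and> (\<forall>v\<in>verts G. \<exists>!e. e \<in> M \<and> v \<in> e)"

end

theory Submission
  imports Defs
begin

text \<open>
  Induction on the number of vertices, for the inequality together with its equality case. Let \<open>K\<close>
  be a largest clique. If \<open>G\<close> is disconnected, or if \<open>G - K\<close> is disconnected and its two sides
  have independence numbers summing to \<open>\<alpha>\<close> (then \<open>K\<close> can be distributed over the two sides without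
  increasing these), the bounds of the two parts add up; if they sum to less, the slack pays for \<open>K\<close>.
  If \<open>G - K\<close> is connected and \<open>h = \<omega>\<close>, then some vertex of \<open>K\<close> has no neighbour
  in \<open>G - K\<close>, so deleting \<open>K\<close> lowers \<open>\<alpha>\<close>. If \<open>h > \<omega>\<close>, take as Duchet and Meyniel do a connected
  dominating set \<open>D\<close> of \<open>G - K\<close> with \<open>2s - 1\<close> vertices, \<open>s \<le> \<alpha>\<close> of them independent, starting next
  to \<open>K\<close>. Either \<open>D\<close> dominates \<open>K\<close>, and deleting \<open>D\<close> lowers \<open>h\<close> but not \<open>\<omega>\<close>; or \<open>s < \<alpha>\<close>, and
  deleting \<open>D\<close> with one vertex of \<open>K\<close> lowers \<open>h\<close> and costs at most one in \<open>\<omega>\<close>.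

  Equality is impossible when \<open>h > \<omega>\<close>. The two delicate situations are \<open>h = 3\<close>, \<open>\<omega> = 2\<close>,
  \<open>n = 4\<alpha> - 1\<close>, excluded by splitting \<open>G\<close> into breadth-first layers, and two cliques of order \<open>\<omega>\<close>
  plus an induced path on three vertices with \<open>\<alpha> = 2\<close>, where a complete minor of order
  \<open>\<omega> + 2\<close> is exhibited.
\<close>

subsection \<open>Independence, cliques and complete minors of vertex sets\<close>

locale adjacency =
  fixes adj :: "'a \<Rightarrow> 'a \<Rightarrow> bool" (infix \<open>\<sim>\<close> 50)
  assumes adj_sym: "u \<sim> v \<Longrightarrow> v \<sim> u"
    and adj_irrefl: "\<not> u \<sim> u"
begin

definition indep :: "'a set \<Rightarrow> bool" where
  "indep S \<longleftrightarrow> (\<forall>u\<in>S. \<forall>v\<in>S. \<not> u \<sim> v)"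

definition clique :: "'a set \<Rightarrow> bool" where
  "clique S \<longleftrightarrow> (\<forall>u\<in>S. \<forall>v\<in>S. u \<noteq> v \<longrightarrow> u \<sim> v)"

definition touch :: "'a set \<Rightarrow> 'a set \<Rightarrow> bool" where
  "touch A B \<longleftrightarrow> (\<exists>a\<in>A. \<exists>b\<in>B. a \<sim> b)"

text \<open>Connectedness by cuts rather than by paths: the growth arguments below need an edge that
  leaves a proper part. The empty set is excluded, as branch sets have to be nonempty.\<close>

definition conn :: "'a set \<Rightarrow> bool" where
  "conn S \<longleftrightarrow> S \<noteq> {} \<and> (\<forall>A. A \<subseteq> S \<and> A \<noteq> {} \<and> A \<noteq> S \<longrightarrow> touch A (S - A))"

text \<open>A set of branch sets suffices in place of an indexed family: being nonempty and
  disjoint, branch sets are distinct, so \<open>card F\<close> is the order of the complete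
  minor.\<close>

definition kmodel :: "'a set set \<Rightarrow> bool" where
  "kmodel F \<longleftrightarrow> (\<forall>B\<in>F. conn B) \<and> (\<forall>B\<in>F. \<forall>C\<in>F. B \<noteq> C \<longrightarrow> B \<inter> C = {} \<and> touch B C)"

definition alpha :: "'a set \<Rightarrow> nat" where
  "alpha X = Max (card ` {S. S \<subseteq> X \<and> indep S})"

definition omega :: "'a set \<Rightarrow> nat" where
  "omega X = Max (card ` {S. S \<subseteq> X \<and> clique S})"

definition had :: "'a set \<Rightarrow> nat" where
  "had X = Max (card ` {F. F \<subseteq> Pow X \<and> kmodel F})"

text \<open>A perfect matching encoded as a partition into edges, a form that passes directly to
  disjoint unions.\<close>

definition matched :: "'a set \<Rightarrow> bool" where
  "matched X \<longleftrightarrow> (\<exists>M. (\<forall>e\<in>M. \<exists>u v. e = {u, v} \<and> u \<sim> v) \<and> disjoint M \<and> \<Union>M = X)"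

lemma touch_sym: "touch A B \<Longrightarrow> touch B A"
  unfolding touch_def using adj_sym by blast

lemma touch_mono: "touch A B \<Longrightarrow> A \<subseteq> A' \<Longrightarrow> B \<subseteq> B' \<Longrightarrow> touch A' B'"
  unfolding touch_def by blast

lemma indep_empty [simp]: "indep {}" by (simp add: indep_def)
lemma clique_empty [simp]: "clique {}" by (simp add: clique_def)
lemma indep_singleton [simp]: "indep {v}" by (simp add: indep_def adj_irrefl)
lemma clique_singleton [simp]: "clique {v}" by (simp add: clique_def)
lemma indep_subset: "indep S \<Longrightarrow> T \<subseteq> S \<Longrightarrow> indep T" by (auto simp: indep_def)
lemma clique_subset: "clique S \<Longrightarrow> T \<subseteq> S \<Longrightarrow> clique T" by (auto simp: clique_def)

lemma indep_insert: "indep S \<Longrightarrow> (\<And>s. s \<in> S \<Longrightarrow> \<not> s \<sim> v) \<Longrightarrow> indep (insert v S)"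
  unfolding indep_def using adj_sym adj_irrefl by blast

lemma indep_Un: "indep S \<Longrightarrow> indep T \<Longrightarrow> \<not> touch S T \<Longrightarrow> indep (S \<union> T)"
  unfolding indep_def touch_def using adj_sym by blast

lemma conn_singleton [simp]: "conn {v}"
  unfolding conn_def by auto

lemma conn_touchD: "conn S \<Longrightarrow> A \<subseteq> S \<Longrightarrow> A \<noteq> {} \<Longrightarrow> A \<noteq> S \<Longrightarrow> touch A (S - A)"
  unfolding conn_def by blast

lemma conn_touch:
  assumes "conn S" "A \<subseteq> S" "A \<noteq> {}" "A \<noteq> S"
  obtains a b where "a \<in> A" "b \<in> S - A" "a \<sim> b"
  using conn_touchD[OF assms] unfolding touch_def by blast

lemma conn_Un:
  assumes S: "conn S" and T: "conn T" and "S \<inter> T \<noteq> {} \<or> touch S T"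
  shows "conn (S \<union> T)"
proof -
  have "touch A (S \<union> T - A)" if A: "A \<subseteq> S \<union> T" "A \<noteq> {}" "A \<noteq> S \<union> T" for A
  proof -
    \<comment> \<open>Either \<open>A\<close> cuts \<open>S\<close> or \<open>T\<close> properly, or
      it contains one of them and misses the other; the hypothesis on the pair is used in the latter
      case only.\<close>
    consider "A \<inter> S \<noteq> {}" "A \<inter> S \<noteq> S" | "A \<inter> T \<noteq> {}" "A \<inter> T \<noteq> T"
      | "S \<subseteq> A" "A \<inter> T = {}" | "T \<subseteq> A" "A \<inter> S = {}"
      using A by blast
    then show ?thesis
    proof cases
      case 1
      then have "touch (A \<inter> S) (S - A \<inter> S)" by (intro conn_touchD[OF S]) auto
      then show ?thesis by (rule touch_mono) auto
    next
      case 2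
      then have "touch (A \<inter> T) (T - A \<inter> T)" by (intro conn_touchD[OF T]) auto
      then show ?thesis by (rule touch_mono) auto
    next
      case 3
      then have "touch S T" using assms(3) by blast
      then show ?thesis by (rule touch_mono) (use 3 in auto)
    next
      case 4
      then have "touch T S" using assms(3) touch_sym by blast
      then show ?thesis by (rule touch_mono) (use 4 in auto)
    qed
  qed
  moreover have "S \<union> T \<noteq> {}" using S unfolding conn_def by blast
  ultimately show ?thesis unfolding conn_def by blast
qed

lemma conn_insert:
  assumes "conn S" "s \<in> S" "s \<sim> v"
  shows "conn (insert v S)"
  using conn_Un[OF assms(1) conn_singleton[of v]] assms(2,3) by (auto simp: touch_def)

lemma disconnected:
  assumes "\<not> conn X" "X \<noteq> {}"
  obtains A B where "X = A \<union> B" "A \<inter> B = {}" "A \<noteq> {}" "B \<noteq> {}" "\<not> touch A B"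
proof -
  from assms obtain A where A: "A \<subseteq> X" "A \<noteq> {}" "A \<noteq> X" "\<not> touch A (X - A)"
    unfolding conn_def by blast
  show thesis by (rule that[of A "X - A"]) (use A in auto)
qed

section \<open>The three invariants of a vertex set\<close>

lemma alpha_ge: "finite X \<Longrightarrow> S \<subseteq> X \<Longrightarrow> indep S \<Longrightarrow> card S \<le> alpha X"
  unfolding alpha_def by (intro Max_ge) auto

lemma alpha_obtain:
  assumes "finite X" obtains S where "S \<subseteq> X" "indep S" "card S = alpha X"
proof -
  have "alpha X \<in> card ` {S. S \<subseteq> X \<and> indep S}"
    unfolding alpha_def using assms by (intro Max_in) (auto intro: exI[of _ "{}"])
  then show thesis using that by auto
qed

lemma omega_ge: "finite X \<Longrightarrow> S \<subseteq> X \<Longrightarrow> clique S \<Longrightarrow> card S \<le> omega X"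
  unfolding omega_def by (intro Max_ge) auto

lemma omega_obtain:
  assumes "finite X" obtains S where "S \<subseteq> X" "clique S" "card S = omega X"
proof -
  have "omega X \<in> card ` {S. S \<subseteq> X \<and> clique S}"
    unfolding omega_def using assms by (intro Max_in) (auto intro: exI[of _ "{}"])
  then show thesis using that by auto
qed

lemma had_ge: "finite X \<Longrightarrow> F \<subseteq> Pow X \<Longrightarrow> kmodel F \<Longrightarrow> card F \<le> had X"
  unfolding had_def by (intro Max_ge) auto

lemma kmodel_empty [simp]: "kmodel {}" by (simp add: kmodel_def)

lemma had_obtain:
  assumes "finite X" obtains F where "F \<subseteq> Pow X" "kmodel F" "card F = had X"
proof -
  have "had X \<in> card ` {F. F \<subseteq> Pow X \<and> kmodel F}"
    unfolding had_def using assms by (intro Max_in) (auto intro: exI[of _ "{}"])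
  then show thesis using that by auto
qed

lemma alpha_mono: "finite Y \<Longrightarrow> X \<subseteq> Y \<Longrightarrow> alpha X \<le> alpha Y"
  by (metis alpha_ge alpha_obtain finite_subset subset_trans)

lemma omega_mono: "finite Y \<Longrightarrow> X \<subseteq> Y \<Longrightarrow> omega X \<le> omega Y"
  by (metis omega_ge omega_obtain finite_subset subset_trans)

lemma had_mono:
  assumes "finite Y" "X \<subseteq> Y" shows "had X \<le> had Y"
proof -
  obtain F where F: "F \<subseteq> Pow X" "kmodel F" "card F = had X"
    using had_obtain assms finite_subset by metis
  then have "F \<subseteq> Pow Y" using assms by blast
  then show ?thesis using had_ge[OF assms(1) _ F(2)] F(3) by simp
qed

lemma alpha_Un_separated:
  assumes "finite A" "finite B" "A \<inter> B = {}" "\<not> touch A B"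
  shows "alpha A + alpha B \<le> alpha (A \<union> B)"
proof -
  obtain S where S: "S \<subseteq> A" "indep S" "card S = alpha A" using alpha_obtain assms by metis
  obtain T where T: "T \<subseteq> B" "indep T" "card T = alpha B" using alpha_obtain assms by metis
  have "indep (S \<union> T)" using S T assms(4) by (intro indep_Un) (auto dest: touch_mono)
  moreover have "card (S \<union> T) = card S + card T"
    using S T assms by (intro card_Un_disjoint) (auto intro: finite_subset)
  ultimately show ?thesis using alpha_ge[of "A \<union> B" "S \<union> T"] S T assms by auto
qed

lemma alpha_pos: "finite X \<Longrightarrow> X \<noteq> {} \<Longrightarrow> 1 \<le> alpha X"
  using alpha_ge[of X "{x}" for x] by force

lemma alpha_ge2:
  assumes "finite X" "\<not> clique X" shows "2 \<le> alpha X"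
proof -
  obtain u v where "u \<in> X" "v \<in> X" "u \<noteq> v" "\<not> u \<sim> v"
    using assms(2) unfolding clique_def by blast
  then have "indep {u, v}" using adj_sym adj_irrefl by (auto simp: indep_def)
  then show ?thesis using alpha_ge[of X "{u,v}"] assms \<open>u \<in> X\<close> \<open>v \<in> X\<close> \<open>u \<noteq> v\<close> by simp
qed

lemma card_indep_Int_clique:
  assumes "finite S" "indep S" "clique C" shows "card (S \<inter> C) \<le> 1"
proof -
  have "\<forall>a\<in>S \<inter> C. \<forall>b\<in>S \<inter> C. a = b" using assms unfolding indep_def clique_def by blast
  then show ?thesis using assms(1) card_le_Suc0_iff_eq[of "S \<inter> C"] by simp
qed

lemma alpha_clique:
  assumes "finite X" "X \<noteq> {}" "clique X" shows "alpha X = 1"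
proof -
  obtain S where "S \<subseteq> X" "indep S" "card S = alpha X" using alpha_obtain assms by metis
  then have "alpha X \<le> 1"
    using card_indep_Int_clique[of S X] assms by (auto intro: finite_subset simp: Int_absorb2)
  then show ?thesis using alpha_pos assms by force
qed

lemma alpha_two_cliques:
  assumes "finite A" "finite B" "clique A" "clique B" shows "alpha (A \<union> B) \<le> 2"
proof -
  obtain S where S: "S \<subseteq> A \<union> B" "indep S" "card S = alpha (A \<union> B)"
    using alpha_obtain assms by (metis finite_UnI)
  have fin: "finite S" using S assms by (meson finite_UnI finite_subset)
  have "S = (S \<inter> A) \<union> (S \<inter> B)" using S by blast
  then have "card S \<le> card (S \<inter> A) + card (S \<inter> B)" by (metis card_Un_le)
  then show ?thesis
    using card_indep_Int_clique[OF fin S(2) assms(3)] card_indep_Int_clique[OF fin S(2) assms(4)] S(3)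
    by simp
qed

lemma clique_pair: "u \<sim> v \<Longrightarrow> clique {u, v}"
  using adj_sym by (auto simp: clique_def)

lemma omega_ge2:
  assumes "finite X" "u \<in> X" "v \<in> X" "u \<sim> v" shows "2 \<le> omega X"
proof -
  have "u \<noteq> v" using assms adj_irrefl by blast
  then show ?thesis using omega_ge[of X "{u,v}"] assms clique_pair by simp
qed

lemma kmodel_singletons: "clique K \<Longrightarrow> kmodel ((\<lambda>x. {x}) ` K)"
  unfolding kmodel_def clique_def touch_def by auto

lemma omega_le_had:
  assumes "finite X" shows "omega X \<le> had X"
proof -
  obtain S where S: "S \<subseteq> X" "clique S" "card S = omega X" using omega_obtain assms by metis
  have "card ((\<lambda>x. {x}) ` S) \<le> had X"
    using S assms by (intro had_ge kmodel_singletons) auto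
  then show ?thesis using S(3) by (simp add: card_image inj_on_def)
qed

lemma kmodel_insert:
  assumes "kmodel F" "conn D" "\<And>B. B \<in> F \<Longrightarrow> D \<inter> B = {} \<and> touch D B"
  shows "kmodel (insert D F)"
  using assms touch_sym unfolding kmodel_def by (metis Int_commute insert_iff)

text \<open>Contracting the dominating set \<open>D\<close> adds a branch set to any complete minor
  of \<open>Y\<close>. This is how deletions are shown to lower the Hadwiger number.\<close>

lemma had_dominated:
  assumes "finite X" "conn D" "D \<subseteq> X" "Y \<subseteq> X - D" "\<And>y. y \<in> Y \<Longrightarrow> \<exists>d\<in>D. d \<sim> y"
  shows "had Y + 1 \<le> had X"
proof -
  have fY: "finite Y" using assms by (meson finite_Diff finite_subset)
  obtain F where F: "F \<subseteq> Pow Y" "kmodel F" "card F = had Y"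
    using had_obtain fY by metis
  have ne: "B \<noteq> {}" if "B \<in> F" for B using F that by (auto simp: kmodel_def conn_def)
  have "kmodel (insert D F)"
  proof (rule kmodel_insert[OF F(2) assms(2)])
    fix B assume B: "B \<in> F"
    then obtain y where "y \<in> B" using ne by blast
    moreover then have "y \<in> Y" using F B by blast
    ultimately show "D \<inter> B = {} \<and> touch D B"
      using assms F B unfolding touch_def by blast
  qed
  moreover have "D \<notin> F" using F assms(2,4) unfolding conn_def by blast
  moreover have "finite F" using F fY by (meson finite_Pow_iff finite_subset)
  ultimately show ?thesis
    using had_ge[of X "insert D F"] F assms by (auto simp: subset_iff)
qed

lemma had_le_card:
  assumes "finite X" shows "had X \<le> card X"
proof -
  obtain F where F: "F \<subseteq> Pow X" "kmodel F" "card F = had X" using had_obtain assms by metis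
  have ne: "B \<noteq> {}" if "B \<in> F" for B using F that by (auto simp: kmodel_def conn_def)
  \<comment> \<open>One vertex per branch set; disjointness makes the choice injective.\<close>
  define f where "f B = (SOME b. b \<in> B)" for B :: "'a set"
  have f: "f B \<in> B" if "B \<in> F" for B using ne[OF that] unfolding f_def by (simp add: some_in_eq)
  have "inj_on f F" 
  proof (rule inj_onI)
    fix B C assume "B \<in> F" "C \<in> F" "f B = f C"
    then show "B = C" using f[of B] f[of C] F(2) unfolding kmodel_def by auto
  qed
  then have "card F = card (f ` F)" by (simp add: card_image)
  also have "\<dots> \<le> card X" using f F assms by (intro card_mono) auto
  finally show ?thesis using F by simp
qed

lemma clique_had:
  assumes "finite X" "clique X" shows "omega X = card X" "had X = card X"
proof -
  have "card X \<le> omega X" using omega_ge assms by blast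
  then show "omega X = card X" "had X = card X"
    using omega_le_had[OF assms(1)] had_le_card[OF assms(1)] by auto
qed

lemma matched_pair: "u \<sim> v \<Longrightarrow> matched {u, v}"
  unfolding matched_def by (rule exI[of _ "{{u,v}}"]) (auto simp: disjoint_def)

lemma matched_Un:
  assumes "matched A" "matched B" "A \<inter> B = {}" shows "matched (A \<union> B)"
proof -
  obtain M where M: "\<forall>e\<in>M. \<exists>u v. e = {u, v} \<and> u \<sim> v" "disjoint M" "\<Union>M = A"
    using assms unfolding matched_def by blast
  obtain N where N: "\<forall>e\<in>N. \<exists>u v. e = {u, v} \<and> u \<sim> v" "disjoint N" "\<Union>N = B"
    using assms unfolding matched_def by blast
  show ?thesis unfolding matched_def
    by (rule exI[of _ "M \<union> N"]) (use M N assms(3) in \<open>auto intro!: disjoint_union\<close>)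
qed

lemma matched_clique2: "clique X \<Longrightarrow> card X = 2 \<Longrightarrow> matched X"
  by (auto simp: card_2_iff clique_def intro!: matched_pair)


subsection \<open>The bound and its extremal sets\<close>

lemma clique_conn:
  assumes "clique S" "S \<noteq> {}" shows "conn S"
proof -
  have "touch A (S - A)" if "A \<subseteq> S" "A \<noteq> {}" "A \<noteq> S" for A
  proof -
    obtain a b where "a \<in> A" "b \<in> S - A" using \<open>A \<subseteq> S\<close> \<open>A \<noteq> {}\<close> \<open>A \<noteq> S\<close> by blast
    moreover from this have "a \<sim> b" using assms(1) \<open>A \<subseteq> S\<close> unfolding clique_def by auto
    ultimately show ?thesis unfolding touch_def by blast
  qed
  then show ?thesis using assms(2) unfolding conn_def by blast
qed

lemma conn_Un_dominated:
  assumes "finite L" "conn Z" "\<And>l. l \<in> L \<Longrightarrow> \<exists>z\<in>Z. z \<sim> l"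
  shows "conn (Z \<union> L)"
  using assms(1,3)
proof (induction L)
  case (insert l L)
  then obtain z where "z \<in> Z" "z \<sim> l" by blast
  moreover have "conn (Z \<union> L)" using insert by blast
  ultimately have "conn (insert l (Z \<union> L))" using conn_insert[of "Z \<union> L" z l] by blast
  then show ?case by simp
qed (use assms(2) in simp)

text \<open>With a second vertex present an edge would have to leave \<open>{u}\<close>, so
  \<open>R\<close> is a single vertex. It serves to show that a connected rest that is not complete
  is not independent either.\<close>

lemma conn_indep_clique:
  assumes "conn R" "indep R" shows "clique R"
proof -
  have "u = v" if "u \<in> R" "v \<in> R" for u v
  proof (rule ccontr)
    assume "u \<noteq> v"
    then have "touch {u} (R - {u})" using that by (intro conn_touchD[OF assms(1)]) auto
    then show False using assms(2) that unfolding touch_def indep_def by blast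
  qed
  then show ?thesis unfolding clique_def by blast
qed

lemma not_indep_omega:
  assumes "finite X" "\<not> indep X" shows "2 \<le> omega X"
  using assms omega_ge2 unfolding indep_def by blast

text \<open>A maximal connected set \<open>D\<close> with the right count dominates: otherwise the
  connectedness of \<open>Y\<close> yields a neighbour \<open>a\<close> of \<open>D\<close> adjacent
  to a vertex \<open>b\<close> at distance two from \<open>D\<close>. Adding both keeps
  \<open>D\<close> connected, and \<open>b\<close> enlarges \<open>S\<close>.\<close>

lemma connected_dominating_set:
  assumes "finite Y" "conn Y" "u \<in> Y"
  obtains D S where "u \<in> D" "D \<subseteq> Y" "conn D" "S \<subseteq> D" "indep S" "card D + 1 = 2 * card S"
    "\<And>y. y \<in> Y - D \<Longrightarrow> \<exists>d\<in>D. d \<sim> y"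
proof -
  define \<D> where "\<D> = {D. u \<in> D \<and> D \<subseteq> Y \<and> conn D \<and> (\<exists>S\<subseteq>D. indep S \<and> card D + 1 = 2 * card S)}"
  have mem: "D \<in> \<D> \<longleftrightarrow> u \<in> D \<and> D \<subseteq> Y \<and> conn D \<and> (\<exists>S\<subseteq>D. indep S \<and> card D + 1 = 2 * card S)" for D
    by (simp add: \<D>_def)
  have "\<D> \<subseteq> Pow Y" using mem by blast
  then have "finite \<D>" using assms(1) by (meson finite_Pow_iff finite_subset)
  moreover have "{u} \<in> \<D>" using assms(3) by (auto simp: mem intro!: exI[of _ "{u}"])
  then have "\<D> \<noteq> {}" by blast
  ultimately obtain D where "D \<in> \<D>" and max: "\<And>D'. D' \<in> \<D> \<Longrightarrow> D \<subseteq> D' \<Longrightarrow> D = D'"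
    using finite_has_maximal[of \<D>] by metis
  then have D: "u \<in> D" "D \<subseteq> Y" "conn D" and "\<exists>S\<subseteq>D. indep S \<and> card D + 1 = 2 * card S"
    by (simp_all add: mem)
  then obtain S where S: "S \<subseteq> D" "indep S" "card D + 1 = 2 * card S" by blast
  have "\<exists>d\<in>D. d \<sim> y" if "y \<in> Y - D" for y
  proof (rule ccontr)
    assume no: "\<not> (\<exists>d\<in>D. d \<sim> y)"
    \<comment> \<open>The closed neighbourhood of \<open>D\<close> in \<open>Y\<close>. It omits
      \<open>y\<close>, so some edge \<open>ab\<close> leaves it.\<close>
    define N where "N = D \<union> {a \<in> Y. \<exists>d\<in>D. d \<sim> a}"
    have "N \<subseteq> Y" "N \<noteq> {}" "N \<noteq> Y" using D that no unfolding N_def by auto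
    then obtain a b where ab: "a \<in> N" "b \<in> Y - N" "a \<sim> b"
      using conn_touch[OF assms(2)] by metis
    have aD: "a \<notin> D" using ab unfolding N_def by blast
    then obtain d where d: "d \<in> D" "d \<sim> a" "a \<in> Y" using ab unfolding N_def by blast
    have b: "b \<notin> D" "b \<noteq> a" "\<And>d. d \<in> D \<Longrightarrow> \<not> d \<sim> b" using ab adj_irrefl unfolding N_def by auto
    have fD: "finite D" using D assms(1) finite_subset by auto
    have "conn (insert b (insert a D))"
      using conn_insert[of "insert a D" a b] conn_insert[of D d a] D d ab by blast
    moreover have "indep (insert b S)" using S b by (intro indep_insert) auto
    moreover have "card (insert b (insert a D)) + 1 = 2 * card (insert b S)"
      using fD aD b S finite_subset[OF S(1) fD] by (auto simp: card_insert_if)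
    ultimately have "insert b (insert a D) \<in> \<D>"
      using D S d ab unfolding mem by (intro conjI exI[of _ "insert b S"]) auto
    then show False using max aD by blast
  qed
  then show thesis using that[of D S] D S by blast
qed

definition bound :: "'a set \<Rightarrow> int" where
  "bound X = (2 * int (alpha X) - 1) * (int (had X) - 1) + 3"

text \<open>
  The case \<open>had X = 2\<close> is kept apart because there equality is inherited by disjoint unions. That such
  an \<open>X\<close> induces a forest is encoded by the value of \<open>had\<close>.
\<close>

definition extremal :: "'a set \<Rightarrow> bool" where
  "extremal X \<longleftrightarrow> (had X = 2 \<and> matched X) \<or>
     (3 \<le> had X \<and> (\<exists>A B. X = A \<union> B \<and> A \<inter> B = {} \<and> clique A \<and> clique B \<and>
        card A = had X \<and> card B = had X))"

text \<open>Independent and complete sets satisfy this vacuously, so the induction hypothesis says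
  nothing about them; \<open>weak_bound\<close> and separate cases treat such parts.\<close>

definition bounded :: "'a set \<Rightarrow> bool" where
  "bounded X \<longleftrightarrow> (\<not> indep X \<and> \<not> clique X \<longrightarrow> int (card X) + int (omega X) \<le> bound X \<and>
     (int (card X) + int (omega X) = bound X \<longrightarrow> extremal X))"

section \<open>Adding up the bounds of two parts, and deleting a largest clique\<close>

lemma boundedI:
  assumes "\<not> indep X \<Longrightarrow> \<not> clique X \<Longrightarrow> int (card X) + int (omega X) \<le> bound X"
    and "\<not> indep X \<Longrightarrow> \<not> clique X \<Longrightarrow> int (card X) + int (omega X) = bound X \<Longrightarrow> extremal X"
  shows "bounded X"
  using assms unfolding bounded_def by blast

text \<open>Replacing \<omega> by 2, its least value once there is an edge, gives a bound that also
  holds for complete and independent sets, and for every upper bound \<open>H\<close> \<ge> 2 on the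
  Hadwiger number. Bounds of several parts can then be added with a common \<open>H\<close>.\<close>

lemma weak_bound:
  assumes "finite X" "X \<noteq> {}" "bounded X" "had X \<le> H" "2 \<le> H"
  shows "int (card X) \<le> (2 * int (alpha X) - 1) * (int H - 1) + 1 \<and>
    (int (card X) = (2 * int (alpha X) - 1) * (int H - 1) + 1 \<longrightarrow>
      (3 \<le> H \<and> clique X \<and> card X = H) \<or> (H = 2 \<and> matched X))"
proof -
  have a1: "1 \<le> alpha X" using alpha_pos assms by blast
  consider "clique X" | "indep X" "\<not> clique X" | "\<not> indep X" "\<not> clique X" by blast
  then show ?thesis
  proof cases
    case 1
    then have "alpha X = 1" "had X = card X" using alpha_clique clique_had assms by auto
    then show ?thesis using 1 assms(4,5) matched_clique2[of X] by (cases "H = 2") auto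
  next
    case 2
    have "card X \<le> alpha X" using alpha_ge[OF assms(1) order_refl 2(1)] .
    moreover have "2 \<le> alpha X" using alpha_ge2 2 assms by blast
    moreover have "2 * int (alpha X) - 1 \<le> (2 * int (alpha X) - 1) * (int H - 1)"
      using a1 assms(5) mult_left_mono[of 1 "int H - 1" "2 * int (alpha X) - 1"] by simp
    ultimately have "int (card X) < (2 * int (alpha X) - 1) * (int H - 1) + 1" by linarith
    then show ?thesis by simp
  next
    case 3
    have w: "2 \<le> omega X" using not_indep_omega 3 assms by blast
    have le: "int (card X) + int (omega X) \<le> bound X"
      and eq: "int (card X) + int (omega X) = bound X \<Longrightarrow> extremal X"
      using assms(3) 3 unfolding bounded_def by auto
    have m: "(2 * int (alpha X) - 1) * (int (had X) - 1) \<le> (2 * int (alpha X) - 1) * (int H - 1)"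
      using a1 assms(4) by (intro mult_left_mono) auto
    have "H = 2 \<and> matched X" if e: "int (card X) = (2 * int (alpha X) - 1) * (int H - 1) + 1"
    proof -
      have w2: "omega X = 2" and be: "int (card X) + int (omega X) = bound X"
        and "(2 * int (alpha X) - 1) * (int (had X) - 1) = (2 * int (alpha X) - 1) * (int H - 1)"
        using e le m w unfolding bound_def by linarith+
      then have hH: "had X = H" using a1 by auto
      from eq[OF be] show ?thesis unfolding extremal_def
      proof (elim disjE conjE exE)
        \<comment> \<open>A clique of order at least 3 contradicts
          \<open>omega X = 2\<close>.\<close>
        fix A B assume "3 \<le> had X" "X = A \<union> B" "clique A" "card A = had X"
        then have "had X \<le> omega X" using omega_ge[OF assms(1), of A] by auto
        then show ?thesis using w2 \<open>3 \<le> had X\<close> by simp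
      qed (use hH in auto)
    qed
    then show ?thesis using le m w unfolding bound_def by auto
  qed
qed

text \<open>Edges between the parts are allowed. The weak bounds with \<open>H = had X\<close> add
  up to \<open>bound X\<close> minus h, and \<omega> \<le> h. In case of equality both parts attain
  their weak bounds, so both are matched or both are cliques of order h.\<close>

lemma bounded_partition:
  assumes fin: "finite X" and X: "X = A \<union> B" "A \<inter> B = {}" "A \<noteq> {}" "B \<noteq> {}"
    and al: "alpha A + alpha B \<le> alpha X" and bd: "bounded A" "bounded B"
  shows "bounded X"
proof (cases "indep X")
  case True
  then show ?thesis by (simp add: bounded_def)
next
  case False
  define h where "h = had X"
  have w2: "2 \<le> omega X" using not_indep_omega fin False by blast
  have wh: "omega X \<le> h" unfolding h_def using omega_le_had fin by blast
  have f: "finite A" "finite B" using fin X by auto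
  have hA: "had A \<le> h" and hB: "had B \<le> h" unfolding h_def using had_mono fin X by auto
  note WA = weak_bound[OF f(1) X(3) bd(1) hA] and WB = weak_bound[OF f(2) X(4) bd(2) hB]
  have h2: "2 \<le> h" using w2 wh by simp
  have card: "int (card X) = int (card A) + int (card B)" using X f by (simp add: card_Un_disjoint)
  have m: "(2 * (int (alpha A) + int (alpha B)) - 2) * (int h - 1) \<le> (2 * int (alpha X) - 2) * (int h - 1)"
    using al h2 by (intro mult_right_mono) auto
  have e: "(2 * int (alpha A) - 1) * (int h - 1) + (2 * int (alpha B) - 1) * (int h - 1) =
      (2 * (int (alpha A) + int (alpha B)) - 2) * (int h - 1)"
    "bound X = (2 * int (alpha X) - 2) * (int h - 1) + int h + 2"
    unfolding bound_def h_def by (simp_all add: algebra_simps)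
  show ?thesis
  proof (rule boundedI)
    show "int (card X) + int (omega X) \<le> bound X"
      using WA WB h2 card m e wh by linarith
    assume eq: "int (card X) + int (omega X) = bound X"
    have "int (card A) = (2 * int (alpha A) - 1) * (int h - 1) + 1"
      "int (card B) = (2 * int (alpha B) - 1) * (int h - 1) + 1"
      using eq WA WB h2 card m e wh by linarith+
    then have A: "(3 \<le> h \<and> clique A \<and> card A = h) \<or> (h = 2 \<and> matched A)"
      and B: "(3 \<le> h \<and> clique B \<and> card B = h) \<or> (h = 2 \<and> matched B)" using WA WB h2 by blast+
    show "extremal X"
    proof (cases "h = 2")
      case True
      then have "matched X" using A B X matched_Un by auto
      then show ?thesis using True unfolding extremal_def h_def by blast
    next
      case False
      then show ?thesis using A B X unfolding extremal_def h_def by blast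
    qed
  qed
qed

text \<open>A larger independent set has to use \<open>v\<close>; what is left of it after deleting
  \<open>v\<close> is the witness.\<close>

lemma alpha_insert_witness:
  assumes "finite A" "alpha (insert v A) \<noteq> alpha A"
  obtains S where "S \<subseteq> A" "indep S" "card S = alpha A" "\<And>s. s \<in> S \<Longrightarrow> \<not> s \<sim> v" "v \<notin> A"
proof -
  have vA: "v \<notin> A" using assms(2) by (auto simp: insert_absorb)
  obtain T where T: "T \<subseteq> insert v A" "indep T" "card T = alpha (insert v A)"
    using alpha_obtain assms by (metis finite_insert)
  have gt: "alpha A < card T" using alpha_mono[of "insert v A" A] assms T by (auto simp: order_less_le)
  have fT: "finite T" using T assms by (meson finite_insert finite_subset)
  have vT: "v \<in> T" using gt alpha_ge[OF assms(1), of T] T by auto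
  have "card (T - {v}) \<le> alpha A" using T assms by (intro alpha_ge) (auto intro: indep_subset)
  then have "card (T - {v}) = alpha A" using gt vT fT by (auto simp: card_Diff_singleton)
  then show thesis
    using that[of "T - {v}"] T vT vA unfolding indep_def by auto
qed

text \<open>An independent set meets the clique in at most one vertex, so it lies in
  \<open>A\<close> or in some \<open>insert v A\<close>.\<close>

lemma alpha_Un_clique:
  assumes "finite A" "finite C" "clique C" "\<And>v. v \<in> C \<Longrightarrow> alpha (insert v A) = alpha A"
  shows "alpha (A \<union> C) = alpha A"
proof (rule antisym)
  obtain S where S: "S \<subseteq> A \<union> C" "indep S" "card S = alpha (A \<union> C)"
    using alpha_obtain assms by (metis finite_UnI)
  show "alpha (A \<union> C) \<le> alpha A"
  proof (cases "S \<subseteq> A")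
    case True
    then show ?thesis using alpha_ge assms S by metis
  next
    case False
    then obtain v where v: "v \<in> S" "v \<in> C" "v \<notin> A" using S by blast
    have "S \<subseteq> insert v A"
    proof
      fix x assume "x \<in> S"
      then show "x \<in> insert v A" using S v assms(3) unfolding indep_def clique_def by blast
    qed
    then show ?thesis using alpha_ge[of "insert v A" S] assms S v by simp
  qed
qed (use assms alpha_mono in auto)

lemma bounded_disconnected_rest:
  assumes fin: "finite X" and K: "K \<subseteq> X" "clique K" "card K = omega X"
    and AB: "X - K = A \<union> B" "A \<inter> B = {}" "A \<noteq> {}" "B \<noteq> {}" "\<not> touch A B"
    and IH: "\<And>Y. Y \<subset> X \<Longrightarrow> bounded Y"
  shows "bounded X"
proof -
  have f: "finite A" "finite B" "finite K" using fin AB K finite_subset[of _ X] by (auto intro: finite_subset)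
  have sum: "alpha A + alpha B \<le> alpha X"
    using alpha_Un_separated[OF f(1,2) AB(2,5)] alpha_mono[of X "A \<union> B"] fin AB by force
  show ?thesis
  proof (cases "alpha A + alpha B = alpha X")
    case True
    \<comment> \<open>If \<open>v\<close> raised both independence numbers, the two witnesses
      together with \<open>v\<close> would be independent of size \<open>alpha X + 1\<close>, as no
      edge joins \<open>A\<close> and \<open>B\<close>.\<close>
    have split: "alpha (insert v A) = alpha A \<or> alpha (insert v B) = alpha B" if v: "v \<in> K" for v
    proof (rule ccontr)
      assume "\<not> ?thesis"
      then obtain S T where S: "S \<subseteq> A" "indep S" "card S = alpha A" "\<And>s. s \<in> S \<Longrightarrow> \<not> s \<sim> v" "v \<notin> A"
        and T: "T \<subseteq> B" "indep T" "card T = alpha B" "\<And>s. s \<in> T \<Longrightarrow> \<not> s \<sim> v" "v \<notin> B"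
        using alpha_insert_witness f by metis
      have "\<not> touch S T" using touch_mono[OF _ S(1) T(1)] AB(5) by blast
      then have "indep (S \<union> T)" using S(2) T(2) indep_Un by blast
      then have "indep (insert v (S \<union> T))" using S T by (intro indep_insert) auto
      moreover have "insert v (S \<union> T) \<subseteq> X" using S T AB K v by blast
      moreover have "card (insert v (S \<union> T)) = Suc (card S + card T)"
      proof -
        have "finite S" "finite T" "S \<inter> T = {}" "v \<notin> S \<union> T"
          using S T f AB by (auto intro: finite_subset)
        then show ?thesis by (simp add: card_Un_disjoint)
      qed
      ultimately show False using alpha_ge[OF fin] S T True by (metis Suc_n_not_le_n)
    qed
    \<comment> \<open>\<open>C\<close> joins the side of \<open>A\<close>; by \<open>split\<close>
      the other vertices of \<open>K\<close> do not raise the independence number of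
      \<open>B\<close>.\<close>
    define C where "C = {v \<in> K. alpha (insert v A) = alpha A}"
    have C: "clique C" "clique (K - C)" "finite C" "finite (K - C)" "C \<subseteq> K"
      using K f unfolding C_def by (auto intro: clique_subset)
    have a: "alpha (A \<union> C) = alpha A" using f C unfolding C_def by (intro alpha_Un_clique) auto
    have b: "alpha (B \<union> (K - C)) = alpha B"
      using f C split by (intro alpha_Un_clique) (auto simp: C_def)
    show ?thesis
    proof (rule bounded_partition[OF fin, of "A \<union> C" "B \<union> (K - C)"])
      show "X = A \<union> C \<union> (B \<union> (K - C))" using AB K C by blast
      show "(A \<union> C) \<inter> (B \<union> (K - C)) = {}" using AB K C by blast
      show "bounded (A \<union> C)" "bounded (B \<union> (K - C))" using AB K C by (intro IH; blast)+
    qed (use AB a b True in auto)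
  next
    case False
    \<comment> \<open>The slack 2(h - 1) covers \<open>K\<close>, which counts once in the order of
      \<open>X\<close> and once as \<omega>: what remains to hold is 2\<omega> + 2 \<le> 3h, with
      equality only for h = \<omega> = 2.\<close>
    then have lt: "alpha A + alpha B + 1 \<le> alpha X" using sum by simp
    show ?thesis
    proof (cases "indep X")
      case True
      then show ?thesis by (simp add: bounded_def)
    next
      case False
      define h where "h = had X"
      have w2: "2 \<le> omega X" using not_indep_omega fin False by blast
      have wh: "omega X \<le> h" unfolding h_def using omega_le_had fin by blast
      have h2: "2 \<le> h" using w2 wh by simp
      have sub: "A \<subset> X" "B \<subset> X" using AB K by blast+
      have hA: "had A \<le> h" and hB: "had B \<le> h" unfolding h_def using had_mono fin sub by auto
      note WA = weak_bound[OF f(1) AB(3) IH[OF sub(1)] hA h2]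
        and WB = weak_bound[OF f(2) AB(4) IH[OF sub(2)] hB h2]
      have XABK: "X = A \<union> B \<union> K" using AB K by blast
      moreover have "(A \<union> B) \<inter> K = {}" using AB by blast
      ultimately have "card X = card (A \<union> B) + card K" using f card_Un_disjoint[of "A \<union> B" K] by simp
      then have card: "int (card X) = int (card A) + int (card B) + int (omega X)"
        using AB(2) f K(3) by (simp add: card_Un_disjoint)
      have m: "(2 * (int (alpha A) + int (alpha B)) - 2) * (int h - 1) \<le> (2 * int (alpha X) - 4) * (int h - 1)"
        using lt h2 by (intro mult_right_mono) auto
      have e: "(2 * int (alpha A) - 1) * (int h - 1) + (2 * int (alpha B) - 1) * (int h - 1) =
          (2 * (int (alpha A) + int (alpha B)) - 2) * (int h - 1)"
        "bound X = (2 * int (alpha X) - 4) * (int h - 1) + 3 * int h"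
        unfolding bound_def h_def by (simp_all add: algebra_simps)
      show ?thesis
      proof (rule boundedI)
        show "int (card X) + int (omega X) \<le> bound X"
          using WA WB h2 card m e wh by linarith
        assume eq: "int (card X) + int (omega X) = bound X"
        have "int (card A) = (2 * int (alpha A) - 1) * (int h - 1) + 1"
          "int (card B) = (2 * int (alpha B) - 1) * (int h - 1) + 1" "h = 2" "omega X = 2"
          using eq WA WB h2 card m e wh w2 by linarith+
        then have "matched A" "matched B" "matched K" using WA WB K matched_clique2 by auto
        then have "matched (A \<union> B \<union> K)" using AB by (intro matched_Un) auto
        then show "extremal X" using XABK \<open>h = 2\<close> unfolding extremal_def h_def by simp
      qed
    qed
  qed
qed

lemma bounded_had_eq_omega:
  assumes fin: "finite X" and K: "K \<subseteq> X" "clique K" "card K = omega X"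
    and R: "conn (X - K)" and hw: "had X = omega X"
    and IH: "\<And>Y. Y \<subset> X \<Longrightarrow> bounded Y"
  shows "bounded X"
proof (cases "indep X \<or> clique X")
  case True
  then show ?thesis by (auto simp: bounded_def)
next
  case False
  define R where "R = X - K"
  define h where "h = had X"
  have w2: "2 \<le> omega X" using not_indep_omega fin False by blast
  then have h2: "2 \<le> h" using hw h_def by simp
  have a2: "2 \<le> alpha X" using alpha_ge2 fin False by blast
  have f: "finite R" "finite K" using fin K finite_subset unfolding R_def by auto
  have XR: "X = R \<union> K" "R \<inter> K = {}" using K unfolding R_def by auto
  \<comment> \<open>If every vertex of \<open>K\<close> had a neighbour in \<open>R\<close>,
    contracting \<open>R\<close> would give a complete minor of order \<omega> + 1.\<close>
  have "\<exists>v\<in>K. \<forall>r\<in>R. \<not> r \<sim> v"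
  proof (rule ccontr)
    assume "\<not> ?thesis"
    then have "\<And>y. y \<in> K \<Longrightarrow> \<exists>d\<in>R. d \<sim> y" by blast
    then have "had K + 1 \<le> had X"
      using had_dominated[OF fin, of R K] R XR unfolding R_def[symmetric] by blast
    then show False using clique_had[of K] K f hw by simp
  qed
  then obtain v where v: "v \<in> K" "\<And>r. r \<in> R \<Longrightarrow> \<not> r \<sim> v" by blast
  have aR: "alpha R + 1 \<le> alpha X"
  proof -
    obtain S where S: "S \<subseteq> R" "indep S" "card S = alpha R" using alpha_obtain f by metis
    have "indep (insert v S)" using S v by (intro indep_insert) auto
    moreover have "card (insert v S) = card S + 1"
      using S v XR f finite_subset[of S R] by (subst card_insert_disjoint) auto
    ultimately show ?thesis using alpha_ge[OF fin, of "insert v S"] S v XR by auto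
  qed
  have sub: "R \<subset> X" using v XR by blast
  have hR: "had R \<le> h" unfolding h_def using had_mono fin sub by auto
  have card: "int (card X) = int (card R) + int h" 
    using XR f K hw by (simp add: card_Un_disjoint h_def)
  have KM: "matched K" if "h = 2" using that matched_clique2[of K] K hw h_def by simp
  show ?thesis
  proof (cases "clique R")
    case True
    have RK: "card R \<le> h" using omega_ge[OF fin _ True] sub hw h_def by auto
    \<comment> \<open>\<open>R\<close> and \<open>K\<close> are cliques of order at most h, so n +
      \<omega> \<le> 3h, while the bound is at least 3h because \<alpha> \<ge> 2.\<close>
    have "3 * (int h - 1) \<le> (2 * int (alpha X) - 1) * (int h - 1)"
      using a2 h2 by (intro mult_right_mono) auto
    then have m: "3 * int h - 3 \<le> (2 * int (alpha X) - 1) * (int h - 1)" by simp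
    show ?thesis
    proof (rule boundedI)
      show "int (card X) + int (omega X) \<le> bound X"
        using m card RK hw unfolding bound_def h_def[symmetric] by linarith
      assume "int (card X) + int (omega X) = bound X"
      then have Rh: "card R = h" using m card RK hw unfolding bound_def h_def[symmetric] by linarith
      show "extremal X"
      proof (cases "h = 2")
        case True
        then have "matched R" using Rh \<open>clique R\<close> matched_clique2 by simp
        then have "matched X" using XR KM True matched_Un by simp
        then show ?thesis using True unfolding extremal_def h_def by blast
      next
        case False
        then show ?thesis using h2 XR K True Rh hw unfolding extremal_def h_def
          by (intro disjI2 conjI exI[of _ R] exI[of _ K]) auto
      qed
    qed
  next
    case nc: False
    have ni: "\<not> indep R" using nc conn_indep_clique R R_def by blast
    have wR: "2 \<le> omega R" using not_indep_omega f ni by blast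
    have le: "int (card R) + int (omega R) \<le> bound R"
      and eqR: "int (card R) + int (omega R) = bound R \<Longrightarrow> extremal R"
      using IH[OF sub] nc ni unfolding bounded_def by auto
    have hR2: "2 \<le> had R" using wR omega_le_had[OF f(1)] by simp
    \<comment> \<open>Passing from \<open>R\<close> to \<open>X\<close> raises the bound by at least
      2(h - 1), and the left side by 2h - \<open>omega R\<close>, which is at most as much.\<close>
    have m1: "(2 * int (alpha R) - 1) * (int (had R) - 1) \<le> (2 * int (alpha X) - 3) * (int (had R) - 1)"
      using aR hR2 by (intro mult_right_mono) auto
    have m2: "(2 * int (alpha X) - 3) * (int (had R) - 1) \<le> (2 * int (alpha X) - 3) * (int h - 1)"
      using a2 hR by (intro mult_left_mono) auto
    have e: "bound X = (2 * int (alpha X) - 3) * (int h - 1) + 2 * int h + 1"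
      unfolding bound_def h_def by (simp add: algebra_simps)
    show ?thesis
    proof (rule boundedI)
      show "int (card X) + int (omega X) \<le> bound X"
        using m1 m2 e card hw le wR unfolding bound_def[of R] h_def[symmetric] by linarith
      assume "int (card X) + int (omega X) = bound X"
      then have wR2: "omega R = 2" and be: "int (card R) + int (omega R) = bound R"
        and m2e: "(2 * int (alpha X) - 3) * (int (had R) - 1) = (2 * int (alpha X) - 3) * (int h - 1)"
        using m1 m2 e card hw le wR unfolding bound_def[of R] h_def[symmetric] by linarith+
      then have hRh: "had R = h" using a2 by auto
      \<comment> \<open>Since \<open>omega R = 2\<close>, only the matched case can occur; then h =
        2 and \<open>K\<close> is one more matching edge.\<close>
      from eqR[OF be] show "extremal X" unfolding extremal_def[of R]
      proof (elim disjE conjE exE)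
        assume "had R = 2" "matched R"
        then have "matched X" "had X = 2" using XR KM hRh matched_Un h_def by auto
        then show ?thesis unfolding extremal_def by blast
      next
        fix A B assume "3 \<le> had R" "R = A \<union> B" "clique A" "card A = had R"
        then have "had R \<le> omega R" using omega_ge[OF f(1), of A] by auto
        then show ?thesis using wR2 \<open>3 \<le> had R\<close> by simp
      qed
    qed
  qed
qed


subsection \<open>Removing a connected dominating set\<close>

lemma alpha_triple:
  assumes "finite X" "alpha X \<le> 2" "{a, b, c} \<subseteq> X" "a \<noteq> b" "a \<noteq> c" "b \<noteq> c"
  shows "a \<sim> b \<or> a \<sim> c \<or> b \<sim> c"
proof (rule ccontr)
  assume "\<not> ?thesis"
  then have "indep {a, b, c}" using adj_sym adj_irrefl unfolding indep_def by blast
  then have "card {a, b, c} \<le> alpha X" using alpha_ge assms by blast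
  then show False using assms by simp
qed

text \<open>
  The branch sets are the single vertices of \<open>L1\<close>, the path \<open>x c z\<close>, and \<open>y\<close> with \<open>L2 - {c}\<close>.
\<close>

lemma two_cliques_path_minor_aux:
  assumes fin: "finite X" and al: "alpha X \<le> 2"
    and L: "clique L1" "clique L2" "L1 \<inter> L2 = {}" "L1 \<subseteq> X" "L2 \<subseteq> X"
    and D: "{x, y, z} \<subseteq> X" "{x, y, z} \<inter> (L1 \<union> L2) = {}" "x \<noteq> z" "\<not> x \<sim> z" "x \<noteq> y" "y \<noteq> z" "x \<sim> y"
    and c: "c \<in> L2" "\<And>l. l \<in> L1 \<Longrightarrow> \<not> l \<sim> c" "x \<sim> c" "z \<sim> c"
    and far: "\<And>l. l \<in> L1 \<Longrightarrow> \<forall>p\<in>L2. \<not> l \<sim> p \<Longrightarrow> y \<sim> l"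
    and q: "q \<in> L2 - {c}" "y \<sim> q"
  shows "card L1 + 2 \<le> had X"
proof -
  define E1 where "E1 = insert y (L2 - {c})"
  define E2 where "E2 = {x, z, c}"
  define F where "F = (\<lambda>l. {l}) ` L1"
  have "clique (L2 - {c})" using L(2) clique_subset by blast
  then have "conn (L2 - {c})" using q(1) clique_conn by blast
  then have c1: "conn E1" unfolding E1_def using conn_insert[of "L2 - {c}" q y] q adj_sym by blast
  have "conn {c, x}" using conn_insert[of "{c}" c x] c(3) adj_sym by (simp add: insert_commute)
  then have c2: "conn E2" unfolding E2_def using conn_insert[of "{c, x}" c z] c(4) adj_sym
    by (simp add: insert_commute)
  have "E1 \<inter> {l} = {} \<and> touch E1 {l}" if l: "l \<in> L1" for l
  proof
    show "E1 \<inter> {l} = {}" using l L D unfolding E1_def by blast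
    show "touch E1 {l}"
    proof (cases "\<forall>p\<in>L2. \<not> l \<sim> p")
      case True
      then show ?thesis using far[OF l] unfolding touch_def E1_def by blast
    next
      case False
      then obtain p where "p \<in> L2" "l \<sim> p" by blast
      \<comment> \<open>\<open>p\<close> differs from \<open>c\<close>, since \<open>c\<close> has
        no neighbour in \<open>L1\<close>.\<close>
      then have "p \<in> E1" "p \<sim> l" using c(2)[OF l] adj_sym unfolding E1_def by auto
      then show ?thesis unfolding touch_def by blast
    qed
  qed
  then have k1: "kmodel (insert E1 F)"
    using c1 kmodel_singletons[OF L(1)] unfolding F_def by (intro kmodel_insert) auto
  have "E2 \<inter> {l} = {} \<and> touch E2 {l}" if l: "l \<in> L1" for l
  proof
    show "E2 \<inter> {l} = {}" using l L D c(1) unfolding E2_def by blast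
    have "x \<noteq> l" "z \<noteq> l" "{x, z, l} \<subseteq> X" using l L D by auto
    \<comment> \<open>\<open>x\<close> and \<open>z\<close> are not adjacent, and no three vertices
      are independent.\<close>
    then have "x \<sim> l \<or> z \<sim> l" using alpha_triple[OF fin al, of x z l] D by blast
    then show "touch E2 {l}" unfolding touch_def E2_def by blast
  qed
  moreover have "E2 \<inter> E1 = {}" using D c(1) unfolding E1_def E2_def by auto
  moreover have "touch E2 E1" using D(7) unfolding touch_def E1_def E2_def by blast
  ultimately have k2: "kmodel (insert E2 (insert E1 F))"
    unfolding F_def by (intro kmodel_insert[OF k1[unfolded F_def] c2]) auto
  have "finite L1" using fin L(4) finite_subset by blast
  then have "finite F" "card F = card L1" unfolding F_def by (auto simp: card_image inj_on_def)
  moreover have "E1 \<notin> F" "E2 \<notin> F" "E2 \<noteq> E1"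
    using D c(1) L unfolding E1_def E2_def F_def by auto
  ultimately have "card (insert E2 (insert E1 F)) = card L1 + 2" by simp
  moreover have "insert E2 (insert E1 F) \<subseteq> Pow X"
    using D L c(1) unfolding E1_def E2_def F_def by auto
  ultimately show ?thesis using had_ge[OF fin _ k2] by simp
qed

text \<open>If every vertex of \<open>A\<close> had a neighbour in \<open>B\<close>, contracting
  \<open>B\<close> would extend \<open>A\<close> to a complete minor of order
  \<open>card A + 1\<close>.\<close>

lemma clique_without_neighbour:
  assumes "finite A" "finite B" "clique A" "clique B" "A \<inter> B = {}" "B \<noteq> {}" "had (A \<union> B) \<le> card A"
  obtains c where "c \<in> A" "\<And>b. b \<in> B \<Longrightarrow> \<not> b \<sim> c"
proof -
  have "\<exists>c\<in>A. \<forall>b\<in>B. \<not> b \<sim> c"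
  proof (rule ccontr)
    assume "\<not> ?thesis"
    then have "\<And>y. y \<in> A \<Longrightarrow> \<exists>d\<in>B. d \<sim> y" by blast
    then have "had A + 1 \<le> had (A \<union> B)"
      using had_dominated[of "A \<union> B" B A] clique_conn assms by blast
    then show False using clique_had[of A] assms by simp
  qed
  then show thesis using that by blast
qed

text \<open>Take \<open>c1\<close> and \<open>c2\<close> without neighbours in the opposite clique;
  both are adjacent to all of \<open>x\<close>, \<open>y\<close>, \<open>z\<close>. If
  \<open>y\<close> has a further neighbour in one of the cliques, the previous construction applies
  with that clique as \<open>L2\<close>. If not, the orders of the cliques give a
  contradiction.\<close>

lemma two_cliques_path_minor:
  assumes fin: "finite X" and al: "alpha X \<le> 2"
    and L: "clique L1" "clique L2" "L1 \<inter> L2 = {}" "L1 \<subseteq> X" "L2 \<subseteq> X"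
    and k: "card L1 = k" "card L2 = k" "omega X \<le> k" "had (L1 \<union> L2) \<le> k" "1 \<le> k"
    and D: "{x, y, z} \<subseteq> X" "{x, y, z} \<inter> (L1 \<union> L2) = {}" "x \<noteq> z" "\<not> x \<sim> z" "x \<noteq> y" "y \<noteq> z" "x \<sim> y"
  shows "k + 2 \<le> had X"
proof -
  have f: "finite L1" "finite L2" using finite_subset[OF L(4) fin] finite_subset[OF L(5) fin] .
  have ne: "L1 \<noteq> {}" "L2 \<noteq> {}" using k by auto
  obtain c1 where c1: "c1 \<in> L1" "\<And>l. l \<in> L2 \<Longrightarrow> \<not> l \<sim> c1"
    using clique_without_neighbour[of L1 L2] f L ne k by metis
  obtain c2 where c2: "c2 \<in> L2" "\<And>l. l \<in> L1 \<Longrightarrow> \<not> l \<sim> c2"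
    using clique_without_neighbour[of L2 L1] f L ne k by (metis Int_commute Un_commute)
  have far: "v \<sim> l" 
    if "v \<in> {x, y, z}" "l \<in> A" "\<And>p. p \<in> B \<Longrightarrow> \<not> p \<sim> l"
      and AB: "A = L1 \<and> B = L2 \<or> A = L2 \<and> B = L1" for v l A B
  proof -
    have v: "v \<in> X" "v \<notin> A" "v \<notin> B" using that D by auto
    have B: "clique B" "card B = k" "B \<subseteq> X" "finite B" "A \<inter> B = {}" "A \<subseteq> X" using AB L k f by auto
    \<comment> \<open>Otherwise \<open>v\<close> would extend \<open>B\<close> to a clique of order
      above \<open>omega X\<close>. In the triple \<open>v\<close>, \<open>l\<close>,
      \<open>b\<close> the pair \<open>v\<close>, \<open>l\<close> is then the only one that can be
      adjacent.\<close>
    have "\<exists>b\<in>B. \<not> v \<sim> b"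
    proof (rule ccontr)
      assume "\<not> ?thesis"
      then have "clique (insert v B)" using B adj_sym unfolding clique_def by auto
      then have "card (insert v B) \<le> omega X" using omega_ge[OF fin] v B by blast
      then show False using v B k by simp
    qed
    then obtain b where b: "b \<in> B" "\<not> v \<sim> b" by blast
    then have "v \<noteq> l" "v \<noteq> b" "l \<noteq> b" "{v, l, b} \<subseteq> X" "\<not> l \<sim> b"
      using v B that(2,3) adj_sym by blast+
    then show ?thesis using alpha_triple[OF fin al, of v l b] b by blast
  qed
  have far1: "v \<sim> l" if "v \<in> {x, y, z}" "l \<in> L1" "\<And>p. p \<in> L2 \<Longrightarrow> \<not> p \<sim> l" for v l
    using far[of v l L1 L2] that by blast
  have far2: "v \<sim> l" if "v \<in> {x, y, z}" "l \<in> L2" "\<And>p. p \<in> L1 \<Longrightarrow> \<not> p \<sim> l" for v l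
    using far[of v l L2 L1] that by blast
  have x1: "x \<sim> c1" "y \<sim> c1" "z \<sim> c1" using far1[of _ c1] c1 by simp_all
  have x2: "x \<sim> c2" "y \<sim> c2" "z \<sim> c2" using far2[of _ c2] c2 by simp_all
  consider q where "q \<in> L2 - {c2}" "y \<sim> q" | q where "q \<in> L1 - {c1}" "y \<sim> q"
    | "\<And>q. q \<in> (L1 - {c1}) \<union> (L2 - {c2}) \<Longrightarrow> \<not> y \<sim> q" by blast
  then show ?thesis
  proof cases
    case (1 q)
    then have "card L1 + 2 \<le> had X"
      using far1[of y] adj_sym
      by (intro two_cliques_path_minor_aux[OF fin al L D c2 x2(1,3) _ 1]) blast+
    then show ?thesis using k by simp
  next
    case (2 q)
    have "{x, y, z} \<inter> (L2 \<union> L1) = {}" "L2 \<inter> L1 = {}" using D(2) L(3) by blast+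
    then have "card L2 + 2 \<le> had X"
      using far2[of y] adj_sym
      by (intro two_cliques_path_minor_aux[OF fin al L(2,1) _ L(5,4) D(1) _ D(3-7) c1 x1(1,3) _ 2]) blast+
    then show ?thesis using k by simp
  next
    case 3
    \<comment> \<open>These non-neighbours of \<open>y\<close> form a clique because \<alpha> \<le>
      2, so 2(k - 1) \<le> k; but \<open>x\<close>, \<open>y\<close>, \<open>c1\<close> form a
      triangle, so k \<ge> 3.\<close>
    define Q where "Q = (L1 - {c1}) \<union> (L2 - {c2})"
    have QX: "Q \<subseteq> X" "y \<notin> Q" using L D unfolding Q_def by auto
    have "clique Q"
      unfolding clique_def
    proof (intro ballI impI)
      fix p q assume pq: "p \<in> Q" "q \<in> Q" "p \<noteq> q"
      then have "{y, p, q} \<subseteq> X" "y \<noteq> p" "y \<noteq> q" using QX D by auto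
      then show "p \<sim> q" using alpha_triple[OF fin al, of y p q] pq 3 unfolding Q_def by blast
    qed
    then have "card Q \<le> k" using omega_ge[OF fin QX(1)] k by simp
    moreover have "card Q = card (L1 - {c1}) + card (L2 - {c2})"
      unfolding Q_def using f L(3) by (intro card_Un_disjoint) auto
    moreover have "clique {x, y, c1}"
      using D(7) x1 adj_sym unfolding clique_def by blast
    then have "card {x, y, c1} \<le> k" using omega_ge[OF fin, of "{x, y, c1}"] D L c1 k by auto
    moreover have "c1 \<noteq> x" "c1 \<noteq> y" using D(2) c1(1) by blast+
    then have "card {x, y, c1} = 3" using D(5) by simp
    ultimately show ?thesis using k c1(1) c2(1) f by simp
  qed
qed

text \<open>
  Grow a connected set by its whole neighbourhood. Each new layer is dominated by a connected
  set, so its Hadwiger number is at most 2 and half of it is independent; layers two steps apart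
  do not touch.
\<close>

lemma layered_independent_sets:
  assumes fin: "finite X" and X: "conn X" "had X \<le> 3" and IH: "\<And>Y. Y \<subset> X \<Longrightarrow> bounded Y"
    and "Y \<subseteq> Z" "Z \<subseteq> X" "conn Z" "\<And>y x. y \<in> Y \<Longrightarrow> x \<in> X \<Longrightarrow> y \<sim> x \<Longrightarrow> x \<in> Z"
    and "I \<subseteq> Z" "J \<subseteq> Y" "indep I" "indep J" "card Z + 2 \<le> 2 * card I + 2 * card J"
  shows "card X + 2 \<le> 4 * alpha X"
  using assms(5-)
proof (induction "card (X - Z)" arbitrary: Y Z I J rule: less_induct)
  case less
  note Z = less.prems
  show ?case
  proof (cases "Z = X")
    case True
    have "card I \<le> alpha X" "card J \<le> alpha X" using Z True by (auto intro!: alpha_ge fin)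
    then show ?thesis using Z(9) True by simp
  next
    case False
    define L where "L = {x \<in> X - Z. \<exists>z\<in>Z. z \<sim> x}"
    have Zne: "Z \<noteq> {}" using Z(3) unfolding conn_def by blast
    obtain a b where "a \<in> Z" "b \<in> X - Z" "a \<sim> b" using conn_touch[OF X(1) Z(2) Zne False] by blast
    then have Lne: "L \<noteq> {}" unfolding L_def by blast
    have LX: "L \<subset> X" using Zne Z(2) unfolding L_def by blast
    have LXZ: "L \<subseteq> X - Z" unfolding L_def by blast
    have fL: "finite L" and fZ: "finite Z" using LX Z(2) fin finite_subset by auto
    have dom: "\<exists>z\<in>Z. z \<sim> y" if "y \<in> L" for y using that unfolding L_def by blast
    have "had L + 1 \<le> had X" using had_dominated[OF fin Z(3,2) LXZ dom] .
    then have "had L \<le> 2" using X(2) by simp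
    then have cL: "card L \<le> 2 * alpha L"
      using weak_bound[OF fL Lne IH[OF LX], of 2] by simp
    obtain T where T: "T \<subseteq> L" "indep T" "card T = alpha L" using alpha_obtain fL by blast
    \<comment> \<open>All neighbours of \<open>Y\<close> lie in \<open>Z\<close>, which
      \<open>T\<close> avoids.\<close>
    have "\<not> touch J T" using Z(4,6) T(1) LXZ unfolding touch_def by blast
    then have JT: "indep (J \<union> T)" using Z(8) T(2) indep_Un by blast
    have fin': "finite J" "finite T" using Z(1,6) fZ T(1) fL finite_subset by (meson, meson)
    have "J \<inter> T = {}" using Z(1,6) T(1) LXZ by blast
    then have cJT: "card (J \<union> T) = card J + card T" using fin' card_Un_disjoint by blast
    have cZ: "card (Z \<union> L) = card Z + card L" using fZ fL LXZ by (intro card_Un_disjoint) auto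
    \<comment> \<open>The two independent sets swap roles: \<open>T\<close> is added to
      \<open>J\<close>, which stays inside \<open>Y\<close>, and the old \<open>I\<close> becomes
      the set inside the new inner part \<open>Z\<close>.\<close>
    show ?thesis
    proof (rule less.hyps[where Y = Z and Z = "Z \<union> L" and I = "J \<union> T" and J = I])
      have "X - (Z \<union> L) \<subset> X - Z" using Lne LXZ by blast
      then show "card (X - (Z \<union> L)) < card (X - Z)" using fin by (intro psubset_card_mono) auto
      show "conn (Z \<union> L)" using conn_Un_dominated[OF fL Z(3) dom] .
      show "x \<in> Z \<union> L" if "y \<in> Z" "x \<in> X" "y \<sim> x" for y x using that unfolding L_def by blast
      show "J \<union> T \<subseteq> Z \<union> L" using Z(1,6) T(1) by blast
      show "card (Z \<union> L) + 2 \<le> 2 * card (J \<union> T) + 2 * card I"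
        using cZ cJT cL T(3) Z(9) by simp
    qed (use Z LX JT in auto)
  qed
qed

text \<open>A vertex \<open>r\<close> and its neighbourhood \<open>N\<close>, independent for lack
  of triangles, start the layering with \<open>I = N\<close> and \<open>J = {r}\<close>; this is
  where the additional 2 is gained. The result n \<le> 4\<alpha> - 2 misses by one the value that
  equality requires for h = 3 and \<omega> = 2.\<close>

lemma triangle_free_had3:
  assumes fin: "finite X" and X: "conn X" "had X \<le> 3" "omega X \<le> 2" "\<not> indep X"
    and IH: "\<And>Y. Y \<subset> X \<Longrightarrow> bounded Y"
  shows "card X + 2 \<le> 4 * alpha X"
proof -
  obtain r s where rs: "r \<in> X" "s \<in> X" "r \<sim> s" using X(4) unfolding indep_def by blast
  define N where "N = {x \<in> X. r \<sim> x}"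
  have fN: "finite N" using fin unfolding N_def by simp
  have "N \<noteq> {}" using rs unfolding N_def by blast
  then have N1: "1 \<le> card N" using fN by (simp add: Suc_le_eq card_gt_0_iff)
  have rN: "r \<notin> N" using adj_irrefl unfolding N_def by blast
  have "indep N" unfolding indep_def
  proof (intro ballI notI)
    fix u v assume uv: "u \<in> N" "v \<in> N" "u \<sim> v"
    then have "clique {r, u, v}" using adj_sym unfolding N_def clique_def by blast
    then have "card {r, u, v} \<le> 2" using omega_ge[OF fin, of "{r, u, v}"] X(3) uv rs unfolding N_def by auto
    moreover have "r \<noteq> u" "r \<noteq> v" "u \<noteq> v" using uv rN adj_irrefl by blast+
    ultimately show False by simp
  qed
  moreover have "conn ({r} \<union> N)" using fN by (intro conn_Un_dominated) (auto simp: N_def)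
  moreover have "card ({r} \<union> N) + 2 \<le> 2 * card N + 2 * card {r}" using rN fN N1 by simp
  ultimately show ?thesis
    using rs by (intro layered_independent_sets[OF fin X(1,2) IH, of "{r}" "{r} \<union> N" N "{r}"])
      (auto simp: N_def)
qed

text \<open>Deleting \<open>D\<close> keeps \<omega>, lowers h, and removes 2s - 1 \<le> 2\<alpha> -
  1 vertices with s = \<open>card S\<close>, no more than the bound loses.\<close>

lemma bounded_remove_dominating:
  assumes fin: "finite X" and X: "conn X" "omega X < had X"
    and K: "K \<subseteq> X" "clique K" "card K = omega X"
    and D: "D \<subseteq> X - K" "conn D" "S \<subseteq> D" "indep S" "card D + 1 = 2 * card S"
      "\<And>y. y \<in> X - D \<Longrightarrow> \<exists>d\<in>D. d \<sim> y"
    and IH: "\<And>Y. Y \<subset> X \<Longrightarrow> bounded Y"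
  shows "bounded X"
proof (cases "indep X \<or> clique X")
  case True
  then show ?thesis by (auto simp: bounded_def)
next
  case False
  define R where "R = X - D"
  define h where "h = had X"
  have w2: "2 \<le> omega X" using not_indep_omega fin False by blast
  have a2: "2 \<le> alpha X" using alpha_ge2 fin False by blast
  have f: "finite R" "finite K" "finite D" "finite S"
    using fin K D finite_subset unfolding R_def by (auto intro: finite_subset)
  have "D \<noteq> {}" using D(2) unfolding conn_def by blast
  then have sub: "R \<subset> X" "K \<subseteq> R" using D K unfolding R_def by blast+
  have "S \<subseteq> X" using D by blast
  then have sa: "card S \<le> alpha X" using alpha_ge fin D(4) by blast
  have XR: "X = R \<union> D" "R \<inter> D = {}" using D unfolding R_def by auto
  have card: "int (card X) = int (card R) + int (card D)" using XR f by (simp add: card_Un_disjoint)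
  have dD: "int (card D) = 2 * int (card S) - 1" using D(5) by linarith
  have wR: "omega R = omega X"
    using omega_mono[OF fin, of R] omega_ge[OF f(1) sub(2) K(2)] K(3) sub by auto
  have "D \<subseteq> X" using D by blast
  then have hR: "had R + 1 \<le> h" unfolding h_def
    using had_dominated[OF fin D(2), of R] D(6) R_def by blast
  have aR: "alpha R \<le> alpha X" using alpha_mono fin sub by auto
  show ?thesis
  proof (cases "clique R")
    \<comment> \<open>The induction hypothesis is void for a complete rest; a direct estimate gives
      strict inequality.\<close>
    case True
    have "card R \<le> omega X" using omega_ge[OF f(1) order_refl True] wR by simp
    have "(2 * int (alpha X) - 1) * (int (omega X)) \<le> (2 * int (alpha X) - 1) * (int h - 1)"
      using a2 X by (intro mult_left_mono) (auto simp: h_def)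
    moreover have "0 \<le> (2 * int (alpha X) - 3) * (int (omega X) - 1)"
      using a2 w2 by (intro mult_nonneg_nonneg) auto
    then have "2 * int (alpha X) - 3 + 3 * int (omega X) \<le> (2 * int (alpha X) - 1) * int (omega X) + int (omega X)"
      by (simp add: algebra_simps)
    ultimately have "int (card X) + int (omega X) < bound X"
      using card dD sa \<open>card R \<le> omega X\<close> unfolding bound_def h_def[symmetric] by linarith
    then show ?thesis by (intro boundedI) auto
  next
    case nc: False
    have ni: "\<not> indep R"
    proof
      assume "indep R"
      then have "card (R \<inter> K) \<le> 1" using card_indep_Int_clique f K by blast
      then show False using sub K w2 by (simp add: Int_absorb1)
    qed
    have le: "int (card R) + int (omega R) \<le> bound R"
      and eqR: "int (card R) + int (omega R) = bound R \<Longrightarrow> extremal R"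
      using IH[OF sub(1)] nc ni unfolding bounded_def by auto
    have hR2: "2 \<le> had R" using w2 wR omega_le_had[OF f(1)] by simp
    have m1: "(2 * int (alpha R) - 1) * (int (had R) - 1) \<le> (2 * int (alpha X) - 1) * (int (had R) - 1)"
      using aR hR2 by (intro mult_right_mono) auto
    have m2: "(2 * int (alpha X) - 1) * (int (had R) - 1) \<le> (2 * int (alpha X) - 1) * (int h - 2)"
      using a2 hR by (intro mult_left_mono) auto
    have e: "bound X = (2 * int (alpha X) - 1) * (int h - 2) + 2 * int (alpha X) + 2"
      unfolding bound_def h_def by (simp add: algebra_simps)
    show ?thesis
    proof (rule boundedI)
      show "int (card X) + int (omega X) \<le> bound X"
        using m1 m2 e card dD sa le wR unfolding bound_def[of R] by linarith
      assume eqX: "int (card X) + int (omega X) = bound X"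
      then have be: "int (card R) + int (omega R) = bound R"
        and m1e: "(2 * int (alpha R) - 1) * (int (had R) - 1) = (2 * int (alpha X) - 1) * (int (had R) - 1)"
        and m2e: "(2 * int (alpha X) - 1) * (int (had R) - 1) = (2 * int (alpha X) - 1) * (int h - 2)"
        and se: "card S = alpha X"
        using m1 m2 e card dD sa le wR unfolding bound_def[of R] by linarith+
      have hRh: "h = had R + 1" using m2e a2 by auto
      have aRe: "alpha R = alpha X" using m1e hR2 by auto
      \<comment> \<open>Equality makes every estimate tight, so \<open>R\<close> is extremal with
        the same \<alpha> and \<open>had R\<close> = h - 1. For \<open>had R = 2\<close> the
        triangle-free estimate is violated. For two cliques \<alpha> = 2, so \<open>D\<close> has
        three vertices, and the path construction yields a complete minor that is too large.\<close>
      from eqR[OF be] have False unfolding extremal_def[of R]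
      proof (elim disjE conjE exE)
        assume "had R = 2"
        then have h3: "h = 3" "omega X = 2" using hRh X w2 h_def by auto
        then have "card X + 2 \<le> 4 * alpha X"
          using triangle_free_had3[OF fin X(1) _ _ _ IH] False h_def by simp
        then show False using eqX h3 unfolding bound_def h_def by simp
      next
        fix A B assume AB: "3 \<le> had R" "R = A \<union> B" "A \<inter> B = {}" "clique A" "clique B"
          "card A = had R" "card B = had R"
        then have "alpha R \<le> 2" using alpha_two_cliques f by simp
        then have a: "alpha X = 2" using aRe a2 by simp
        then have cS: "card S = 2" "card D = 3" using se D(5) by auto
        obtain x z where xz: "S = {x, z}" "x \<noteq> z" using cS by (auto simp: card_2_iff)
        have "card (D - S) = 1" using cS D(3) f by (simp add: card_Diff_subset)
        then obtain y where y: "D - S = {y}" using card_1_singletonE by blast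
        have Dxyz: "D = {x, y, z}" "x \<noteq> y" "y \<noteq> z" using y xz D(3) by auto
        have nxz: "\<not> x \<sim> z" using D(4) xz unfolding indep_def by blast
        have "touch {x} (D - {x})" using Dxyz by (intro conn_touchD[OF D(2)]) auto
        then have xy: "x \<sim> y" using Dxyz nxz unfolding touch_def by blast
        have wl: "omega X \<le> had R" using hRh X h_def by simp
        have "had R + 2 \<le> had X"
        proof (rule two_cliques_path_minor[OF fin _ AB(4,5,3)])
          show "A \<subseteq> X" "B \<subseteq> X" "{x, y, z} \<subseteq> X" using AB(2) XR Dxyz by auto
          show "{x, y, z} \<inter> (A \<union> B) = {}" using AB(2) XR(2) Dxyz(1) by blast
        qed (use AB a wl Dxyz nxz xz xy in auto)
        then show False using hRh h_def by simp
      qed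
      then show "extremal X" ..
    qed
  qed
qed

text \<open>The undominated \<open>v\<close> extends \<open>S\<close>, so only 2s \<le> 2\<alpha> -
  2 vertices are deleted, where s = \<open>card S\<close>. As \<open>w\<close> dominates the rest of
  \<open>K\<close>, h drops; the vertex saved pays for a drop of \<omega> by one.\<close>

lemma bounded_remove_dominating_insert:
  assumes fin: "finite X" and X: "omega X < had X"
    and K: "K \<subseteq> X" "clique K" "card K = omega X"
    and D: "D \<subseteq> X - K" "conn D" "S \<subseteq> D" "indep S" "card D + 1 = 2 * card S"
      "\<And>y. y \<in> X - K - D \<Longrightarrow> \<exists>d\<in>D. d \<sim> y"
    and w: "w \<in> K" "d \<in> D" "d \<sim> w"
    and v: "v \<in> K" "\<And>d. d \<in> D \<Longrightarrow> \<not> d \<sim> v"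
    and IH: "\<And>Y. Y \<subset> X \<Longrightarrow> bounded Y"
  shows "bounded X"
proof (cases "indep X \<or> clique X")
  case True
  then show ?thesis by (auto simp: bounded_def)
next
  case False
  define R where "R = X - insert w D"
  define h where "h = had X"
  have w2: "2 \<le> omega X" using not_indep_omega fin False by blast
  have a2: "2 \<le> alpha X" using alpha_ge2 fin False by blast
  have h3: "3 \<le> h" using w2 X h_def by simp
  have f: "finite R" "finite K" "finite D" "finite S"
    using fin K D finite_subset unfolding R_def by (auto intro: finite_subset)
  have sub: "R \<subset> X" "K - {w} \<subseteq> R" using D K w unfolding R_def by blast+
  have vS: "v \<notin> S" using D(1,3) v(1) by blast
  have "indep (insert v S)" using D v by (intro indep_insert) auto
  moreover have "insert v S \<subseteq> X" using D K v by blast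
  ultimately have "card (insert v S) \<le> alpha X" using alpha_ge[OF fin] by blast
  then have sa: "int (card S) + 1 \<le> int (alpha X)" using vS f by simp
  have wD: "w \<notin> D" using w D by blast
  have XR: "X = R \<union> insert w D" "R \<inter> insert w D = {}" using D w K unfolding R_def by auto
  have card: "int (card X) = int (card R) + 2 * int (card S)"
  proof -
    have "card X = card R + card (insert w D)" using XR f by (metis card_Un_disjoint finite_insert)
    then show ?thesis using D(5) wD f by simp
  qed
  have wR: "omega X \<le> omega R + 1"
    using omega_ge[OF f(1) sub(2) clique_subset[OF K(2)]] K(3) w f by simp
  have cD: "conn (insert w D)" using conn_insert[OF D(2) w(2,3)] .
  have "\<exists>d\<in>insert w D. d \<sim> y" if y: "y \<in> R" for y
  proof (cases "y \<in> K")
    case True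
    then have "w \<noteq> y" using y unfolding R_def by blast
    then have "w \<sim> y" using True w(1) K(2) unfolding clique_def by blast
    then show ?thesis by blast
  next
    case False
    then show ?thesis using D(6)[of y] y unfolding R_def by blast
  qed
  then have hR: "had R + 1 \<le> h" unfolding h_def
    using had_dominated[OF fin cD, of R] XR by blast
  have aR: "alpha R \<le> alpha X" using alpha_mono fin sub by auto
  show ?thesis
  proof (cases "clique R")
    case True
    have "int (card R) \<le> int h - 1" using clique_had(2)[OF f(1) True] hR by simp
    \<comment> \<open>A product chosen so that its expansion bounds (2\<alpha> - 1)(h - 1) below by
      a linear expression.\<close>
    moreover have "0 \<le> (2 * int (alpha X) - 3) * (int h - 3)"
      using a2 h3 by (intro mult_nonneg_nonneg) auto
    then have "(2 * int (alpha X) - 1) * (int h - 1) \<ge> 4 * int (alpha X) + 2 * int h - 8"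
      by (simp add: algebra_simps)
    moreover have "int (omega X) \<le> int h - 1" using X h_def by simp
    ultimately have "int (card X) + int (omega X) < bound X"
      using card sa a2 unfolding bound_def h_def[symmetric] by linarith
    then show ?thesis by (intro boundedI) auto
  next
    case nc: False
    show ?thesis
    proof (cases "indep R")
      case True
      have "card (R \<inter> (K - {w})) \<le> 1"
        using card_indep_Int_clique[OF f(1) True clique_subset[OF K(2)]] by blast
      then have "omega X \<le> 2" using sub K w f by (simp add: Int_absorb1)
      moreover have "card R \<le> alpha X" using alpha_ge[OF fin _ True] sub by blast
      moreover have "(2 * int (alpha X) - 1) * 2 \<le> (2 * int (alpha X) - 1) * (int h - 1)"
        using a2 h3 by (intro mult_left_mono) auto
      then have "4 * int (alpha X) - 2 \<le> (2 * int (alpha X) - 1) * (int h - 1)" by simp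
      ultimately have "int (card X) + int (omega X) < bound X"
        using card sa a2 unfolding bound_def h_def[symmetric] by linarith
      then show ?thesis by (intro boundedI) auto
    next
      case ni: False
      have le: "int (card R) + int (omega R) \<le> bound R"
        and eqR: "int (card R) + int (omega R) = bound R \<Longrightarrow> extremal R"
        using IH[OF sub(1)] nc ni unfolding bounded_def by auto
      have wR2: "2 \<le> omega R" using not_indep_omega f ni by blast
      have hR2: "2 \<le> had R" using wR2 omega_le_had[OF f(1)] by simp
      have m1: "(2 * int (alpha R) - 1) * (int (had R) - 1) \<le> (2 * int (alpha X) - 1) * (int (had R) - 1)"
        using aR hR2 by (intro mult_right_mono) auto
      have m2: "(2 * int (alpha X) - 1) * (int (had R) - 1) \<le> (2 * int (alpha X) - 1) * (int h - 2)"
        using a2 hR by (intro mult_left_mono) auto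
      have e: "bound X = (2 * int (alpha X) - 1) * (int h - 2) + 2 * int (alpha X) + 2"
        unfolding bound_def h_def by (simp add: algebra_simps)
      show ?thesis
      proof (rule boundedI)
        show "int (card X) + int (omega X) \<le> bound X"
          using m1 m2 e card sa le wR unfolding bound_def[of R] by linarith
        assume eqX: "int (card X) + int (omega X) = bound X"
        then have be: "int (card R) + int (omega R) = bound R"
          and m2e: "(2 * int (alpha X) - 1) * (int (had R) - 1) = (2 * int (alpha X) - 1) * (int h - 2)"
          and we: "omega X = omega R + 1"
          using m1 m2 e card sa le wR unfolding bound_def[of R] by linarith+
        have hRh: "h = had R + 1" using m2e a2 by auto
        \<comment> \<open>Both kinds of extremal \<open>R\<close> have \<open>omega R\<close> \<ge>
          h - 1, and \<omega> = \<open>omega R\<close> + 1 would then reach h.\<close>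
        from eqR[OF be] have False unfolding extremal_def[of R]
        proof (elim disjE conjE exE)
          assume "had R = 2"
          then show False using hRh wR2 we X h_def by simp
        next
          fix A B assume "R = A \<union> B" "clique A" "card A = had R"
          then have "had R \<le> omega R" using omega_ge[OF f(1), of A] by auto
          then show False using hRh we X h_def by simp
        qed
        then show "extremal X" ..
      qed
    qed
  qed
qed

section \<open>The induction over finite vertex sets\<close>

theorem bounded_finite: "finite X \<Longrightarrow> bounded X"
proof (induction X rule: finite_psubset_induct)
  case (psubset X)
  note fin = psubset.hyps and IH = psubset.IH
  show ?case
  proof (cases "indep X \<or> clique X")
    case True
    then show ?thesis by (auto simp: bounded_def)
  next
    case False
    have Xne: "X \<noteq> {}" using False by auto
    show ?thesis
    proof (cases "conn X")
      case False
      then obtain A B where AB: "X = A \<union> B" "A \<inter> B = {}" "A \<noteq> {}" "B \<noteq> {}" "\<not> touch A B"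
        using disconnected Xne by metis
      have "finite A" "finite B" using AB fin by auto
      then have "alpha A + alpha B \<le> alpha X" using alpha_Un_separated AB by simp
      moreover have "A \<subset> X" "B \<subset> X" using AB by blast+
      ultimately show ?thesis using bounded_partition[OF fin AB(1-4)] IH by blast
    next
      case True
      obtain K where K: "K \<subseteq> X" "clique K" "card K = omega X" using omega_obtain fin by blast
      have KX: "K \<noteq> X" using K False by blast
      then have Rne: "X - K \<noteq> {}" using K by blast
      show ?thesis
      proof (cases "conn (X - K)")
        case ncR: False
        obtain A B where "X - K = A \<union> B" "A \<inter> B = {}" "A \<noteq> {}" "B \<noteq> {}" "\<not> touch A B"
          using disconnected[OF ncR Rne] by metis
        then show ?thesis using bounded_disconnected_rest[OF fin K] IH by blast
      next
        case cR: True
        show ?thesis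
        proof (cases "had X = omega X")
          case True
          then show ?thesis using bounded_had_eq_omega[OF fin K cR] IH by blast
        next
          case False
          then have lt: "omega X < had X" using omega_le_had[OF fin] by simp
          have "2 \<le> omega X" using not_indep_omega fin \<open>\<not> (indep X \<or> clique X)\<close> by blast
          then have Kne: "K \<noteq> {}" using K by auto
          \<comment> \<open>The edge from \<open>K\<close> to the rest determines where
            \<open>D\<close> starts, so that \<open>insert w D\<close> is connected.\<close>
          obtain w u where w: "w \<in> K" "u \<in> X - K" "w \<sim> u"
            using conn_touch[OF True K(1) Kne KX] by blast
          have "finite (X - K)" using fin by simp
          then obtain D S where D: "u \<in> D" "D \<subseteq> X - K" "conn D" "S \<subseteq> D" "indep S"
            "card D + 1 = 2 * card S" "\<And>y. y \<in> X - K - D \<Longrightarrow> \<exists>d\<in>D. d \<sim> y"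
            using connected_dominating_set[OF _ cR w(2)] by metis
          show ?thesis
          proof (cases "\<exists>v\<in>K. \<forall>d\<in>D. \<not> d \<sim> v")
            case nd: True
            then obtain v where "v \<in> K" "\<And>d. d \<in> D \<Longrightarrow> \<not> d \<sim> v" by blast
            then show ?thesis
              using bounded_remove_dominating_insert[OF fin lt K D(2-7) w(1) D(1) adj_sym[OF w(3)]] IH
              by blast
          next
            case dom: False
            have "\<exists>d\<in>D. d \<sim> y" if "y \<in> X - D" for y
              using dom D(7)[of y] that by blast
            then show ?thesis using bounded_remove_dominating[OF fin True lt K D(2-6)] IH by blast
          qed
        qed
      qed
    qed
  qed
qed


subsection \<open>Matchings, cycles and the graph invariants\<close>

text \<open>An independent set takes at most one vertex from each matching edge. For h = \<omega> =
  2 the bound reads n \<le> 2\<alpha>, so this yields equality in (i).\<close>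

lemma matched_alpha:
  assumes "finite X" "matched X" shows "2 * alpha X \<le> card X"
proof -
  obtain M where M: "\<And>e. e \<in> M \<Longrightarrow> \<exists>u v. e = {u, v} \<and> u \<sim> v" "disjoint M" "\<Union>M = X"
    using assms(2) unfolding matched_def by blast
  obtain S where S: "S \<subseteq> X" "indep S" "card S = alpha X" using alpha_obtain assms by blast
  have fS: "finite S" using S(1) assms(1) finite_subset by blast
  have "M \<subseteq> Pow X" using M(3) by blast
  then have fM: "finite M" using assms(1) by (meson finite_Pow_iff finite_subset)
  have e2: "card e = 2 \<and> clique e" if "e \<in> M" for e
  proof -
    obtain u v where uv: "e = {u, v}" "u \<sim> v" using M(1) \<open>e \<in> M\<close> by blast
    then have "u \<noteq> v" using adj_irrefl by blast
    then show ?thesis using uv clique_pair by simp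
  qed
  have "finite e" if "e \<in> M" for e using e2[OF that] card.infinite by force
  then have "card (\<Union>M) = (\<Sum>e\<in>M. card e)" using M(2) by (intro card_Union_disjoint) auto
  then have cX: "card X = 2 * card M" using e2 M(3) by simp
  have "S = (\<Union>e\<in>M. S \<inter> e)" using S(1) M(3) by blast
  then have "card S \<le> (\<Sum>e\<in>M. card (S \<inter> e))" using card_UN_le[OF fM, of "\<lambda>e. S \<inter> e"] by simp
  also have "\<dots> \<le> (\<Sum>e\<in>M. 1)"
    using card_indep_Int_clique[OF fS S(2)] e2 by (intro sum_mono) blast
  finally show ?thesis using cX S(3) by simp
qed

text \<open>No edge leaves the set of vertices reached from \<open>a\<close> by such paths, so it is
  all of \<open>A\<close>.\<close>

lemma conn_path:
  assumes "conn A" "a \<in> A" "b \<in> A"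
  obtains p where "p \<noteq> []" "hd p = a" "last p = b" "set p \<subseteq> A" "distinct p" "successively (\<sim>) p"
proof -
  define P where "P p b \<longleftrightarrow> p \<noteq> [] \<and> hd p = a \<and> last p = b \<and> set p \<subseteq> A \<and> distinct p \<and> successively (\<sim>) p"
    for p b
  define R where "R = {v. \<exists>p. P p v}"
  have RA: "R \<subseteq> A" unfolding R_def P_def by force
  have "P [a] a" using assms(2) unfolding P_def by simp
  then have aR: "a \<in> R" unfolding R_def by blast
  have "R = A"
  proof (rule ccontr)
    assume "R \<noteq> A"
    then obtain x y where xy: "x \<in> R" "y \<in> A - R" "x \<sim> y" using conn_touch[OF assms(1) RA] aR by blast
    then obtain p where p: "P p x" unfolding R_def by blast
    have "y \<notin> set p"
    proof
      assume "y \<in> set p"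
      then obtain p1 p2 where "p = p1 @ y # p2" by (meson split_list)
      \<comment> \<open>If \<open>y\<close> already lies on \<open>p\<close>, cutting
        \<open>p\<close> off at \<open>y\<close> gives a path to \<open>y\<close>.\<close>
      then have "P (p1 @ [y]) y" using p unfolding P_def
        by (auto simp: successively_append_iff hd_append split: if_splits)
      then show False using xy(2) unfolding R_def by blast
    qed
    then have "P (p @ [y]) y" using p xy unfolding P_def by (auto simp: successively_append_iff)
    then show False using xy(2) unfolding R_def by blast
  qed
  then obtain p where "P p b" using assms(3) unfolding R_def by blast
  then show thesis using that unfolding P_def by blast
qed

lemma conn_successively: "p \<noteq> [] \<Longrightarrow> successively (\<sim>) p \<Longrightarrow> conn (set p)"
proof (induction p rule: induct_list012)
  case (3 x y zs)
  then have "conn (insert x (set (y # zs)))"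
    using adj_sym by (intro conn_insert[of _ y]) auto
  then show ?case by simp
qed auto

text \<open>Take three branch sets and an edge between any two of them. A path inside each branch
  set joins the ends of its two edges, and the three paths close up; each contributes at least one
  vertex.\<close>

lemma cycle_of_had3:
  assumes "finite X" "3 \<le> had X"
  obtains p where "set p \<subseteq> X" "distinct p" "3 \<le> length p" "successively (\<sim>) p" "last p \<sim> hd p"
proof -
  obtain F where F: "F \<subseteq> Pow X" "kmodel F" "card F = had X" using had_obtain assms by blast
  then obtain T where T: "T \<subseteq> F" "card T = 3" using assms(2) by (metis obtain_subset_with_card_n)
  then obtain A B C where ABC: "T = {A, B, C}" "A \<noteq> B" "A \<noteq> C" "B \<noteq> C" by (auto simp: card_3_iff)
  then have mem: "A \<in> F" "B \<in> F" "C \<in> F" using T by auto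
  have con: "conn A" "conn B" "conn C" and sub: "A \<subseteq> X" "B \<subseteq> X" "C \<subseteq> X"
    using F mem unfolding kmodel_def by auto
  have pair: "D \<inter> E = {} \<and> touch D E" if "D \<in> F" "E \<in> F" "D \<noteq> E" for D E
    using F(2) that unfolding kmodel_def by blast
  have dis: "A \<inter> B = {}" "A \<inter> C = {}" "B \<inter> C = {}" using pair mem ABC by auto
  obtain a1 b0 where ab: "a1 \<in> A" "b0 \<in> B" "a1 \<sim> b0" using pair[OF mem(1,2) ABC(2)] unfolding touch_def by blast
  obtain b1 c0 where bc: "b1 \<in> B" "c0 \<in> C" "b1 \<sim> c0" using pair[OF mem(2,3) ABC(4)] unfolding touch_def by blast
  obtain c1 a0 where ca: "c1 \<in> C" "a0 \<in> A" "c1 \<sim> a0"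
    using pair[OF mem(1,3) ABC(3)] adj_sym unfolding touch_def by blast
  obtain p where p: "p \<noteq> []" "hd p = a0" "last p = a1" "set p \<subseteq> A" "distinct p" "successively (\<sim>) p"
    using conn_path[OF con(1) ca(2) ab(1)] .
  obtain q where q: "q \<noteq> []" "hd q = b0" "last q = b1" "set q \<subseteq> B" "distinct q" "successively (\<sim>) q"
    using conn_path[OF con(2) ab(2) bc(1)] .
  obtain r where r: "r \<noteq> []" "hd r = c0" "last r = c1" "set r \<subseteq> C" "distinct r" "successively (\<sim>) r"
    using conn_path[OF con(3) bc(2) ca(1)] .
  show thesis
  proof (rule that[of "p @ q @ r"])
    show "set (p @ q @ r) \<subseteq> X" using p(4) q(4) r(4) sub by auto
    have "set p \<inter> (set q \<union> set r) = {}" "set q \<inter> set r = {}" using p(4) q(4) r(4) dis by blast+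
    then show "distinct (p @ q @ r)" using p(5) q(5) r(5) by simp
    have "1 \<le> length p" "1 \<le> length q" "1 \<le> length r" using p(1) q(1) r(1) by (simp_all add: Suc_le_eq)
    then show "3 \<le> length (p @ q @ r)" by simp
    show "successively (\<sim>) (p @ q @ r)" using p q r ab bc by (simp add: successively_append_iff)
    show "last (p @ q @ r) \<sim> hd (p @ q @ r)" using p q r ca by simp
  qed
qed

text \<open>The first two vertices and the remaining path of the cycle serve as three branch
  sets.\<close>

lemma had3_of_cycle:
  assumes "finite X" "set p \<subseteq> X" "distinct p" "3 \<le> length p" "successively (\<sim>) p" "last p \<sim> hd p"
  shows "3 \<le> had X"
proof -
  obtain x y z s where p: "p = x # y # z # s" using assms(4)
    by (metis (no_types, lifting) Suc_le_length_iff numeral_3_eq_3)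
  let ?B = "set (z # s)"
  have "conn ?B" using assms(5) unfolding p by (intro conn_successively) auto
  moreover have "touch {x} {y}" "touch {y} ?B" using assms(5) unfolding p touch_def by auto
  moreover have "touch ?B {x}" unfolding touch_def
    by (rule bexI[of _ "last (z # s)"]) (use assms(6) in \<open>auto simp: p\<close>)
  moreover have ne: "x \<noteq> y" "x \<notin> ?B" "y \<notin> ?B" using assms(3) unfolding p by auto
  ultimately have "kmodel {{x}, {y}, ?B}" using touch_sym unfolding kmodel_def by simp blast
  moreover have "card {{x}, {y}, ?B} = 3"
  proof -
    have "{x} \<noteq> {y}" "{x} \<noteq> ?B" "{y} \<noteq> ?B" using ne by blast+
    then show ?thesis by (simp only: card_3_iff) blast
  qed
  moreover have "{{x}, {y}, ?B} \<subseteq> Pow X" using assms(2) unfolding p by auto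
  ultimately show ?thesis using had_ge[OF assms(1), of "{{x}, {y}, ?B}"] by simp
qed

text \<open>Links cuts to the library's reachability: no edge leaves a reachable set, and a set that
  no edge leaves is closed under reachability.\<close>

lemma conn_iff_rtrancl_on:
  "conn B \<longleftrightarrow> B \<noteq> {} \<and> (\<forall>u\<in>B. \<forall>v\<in>B. (u, v) \<in> rtrancl_on B {(u, v). u \<in> B \<and> v \<in> B \<and> u \<sim> v})"
    (is "_ \<longleftrightarrow> _ \<and> (\<forall>u\<in>B. \<forall>v\<in>B. (u, v) \<in> ?R)")
proof (intro iffI conjI ballI)
  assume B: "conn B"
  then show "B \<noteq> {}" unfolding conn_def by blast
  fix u v assume uv: "u \<in> B" "v \<in> B"
  define A where "A = {w \<in> B. (u, w) \<in> ?R}"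
  have A: "A \<subseteq> B" "u \<in> A" using uv unfolding A_def by auto
  have "A = B"
  proof (rule ccontr)
    assume "A \<noteq> B"
    then obtain x y where xy: "x \<in> A" "y \<in> B - A" "x \<sim> y" using conn_touch[OF B A(1)] A(2) by blast
    then have "(u, y) \<in> ?R" unfolding A_def by (auto intro: rtrancl_on_into_rtrancl_on)
    then show False using xy unfolding A_def by blast
  qed
  then show "(u, v) \<in> ?R" using uv unfolding A_def by blast
next
  assume *: "B \<noteq> {} \<and> (\<forall>u\<in>B. \<forall>v\<in>B. (u, v) \<in> ?R)"
  have "touch A (B - A)" if A: "A \<subseteq> B" "A \<noteq> {}" "A \<noteq> B" for A
  proof (rule ccontr)
    assume no: "\<not> touch A (B - A)"
    obtain a b where ab: "a \<in> A" "b \<in> B - A" using A by blast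
    then have "(a, b) \<in> ?R" using * A by blast
    then have "b \<in> A"
    proof (induction rule: rtrancl_on_induct)
      case base
      then show ?case using ab by simp
    next
      case (step y z)
      then show ?case using no unfolding touch_def by blast
    qed
    then show False using ab by blast
  qed
  then show "conn B" using * unfolding conn_def by blast
qed

end

section \<open>Translation to the library's graphs\<close>

context graph
begin

lemma adjacency_arcs: "adjacency (\<lambda>u v. u \<rightarrow>\<^bsub>G\<^esub> v)"
  by unfold_locales (use graph_symmetric adj_not_same in auto)

interpretation adj: adjacency "\<lambda>u v. u \<rightarrow>\<^bsub>G\<^esub> v"
  by (rule adjacency_arcs)

lemma arcs_ends_induce_subgraph: "arcs_ends (G \<restriction> B) = {(u, v). u \<in> B \<and> v \<in> B \<and> u \<rightarrow>\<^bsub>G\<^esub> v}"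
  by (auto simp: arcs_ends_conv)

text \<open>The library asks for strong connectivity of the symmetric closure; the induced subgraph
  is symmetric already, so plain reachability remains.\<close>

lemma connected_induce_iff: "Digraph_Component.connected (G \<restriction> B) \<longleftrightarrow> adj.conn B"
proof -
  interpret B: wf_digraph "G \<restriction> B" by auto
  have "symmetric (G \<restriction> B)"
    using graph_symmetric unfolding symmetric_def arcs_ends_induce_subgraph by (auto intro!: symI)
  then show ?thesis
    unfolding connected_def strongly_connected_def adj.conn_iff_rtrancl_on
    by (simp add: B.reachable_mk_symmetric_eq) (simp add: reachable_def arcs_ends_induce_subgraph)
qed

lemma independence_number_eq: "independence_number G = adj.alpha (verts G)"
proof -
  have "{card S |S. independent_set G S} = card ` {S. S \<subseteq> verts G \<and> adj.indep S}"
    unfolding independent_set_def adj.indep_def by auto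
  then show ?thesis unfolding independence_number_def adj.alpha_def by simp
qed

text \<open>The vertex set is kept on the left so that one fact serves both the clique number and
  the disjoint cliques of (ii). The induced subgraph is the witness.\<close>

lemma complete_subgraph_iff:
  "(\<exists>H. subgraph H G \<and> K\<^bsub>k\<^esub> H \<and> verts H = S) \<longleftrightarrow> S \<subseteq> verts G \<and> adj.clique S \<and> card S = k"
proof
  assume "\<exists>H. subgraph H G \<and> K\<^bsub>k\<^esub> H \<and> verts H = S"
  then obtain H where H: "subgraph H G" "K\<^bsub>k\<^esub> H" "verts H = S" by blast
  have "tail H = tail G" "head H = head G" "arcs H \<subseteq> arcs G"
    using H(1) unfolding subgraph_def compatible_def by auto
  then have "arcs_ends H \<subseteq> arcs_ends G" by (auto simp: arcs_ends_conv)
  then have "adj.clique S" using H(2,3) unfolding complete_digraph_def adj.clique_def by auto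
  then show "S \<subseteq> verts G \<and> adj.clique S \<and> card S = k"
    using H unfolding complete_digraph_def subgraph_def by auto
next
  assume S: "S \<subseteq> verts G \<and> adj.clique S \<and> card S = k"
  have "induced_subgraph (G \<restriction> S) G" using S by blast
  then have sub: "subgraph (G \<restriction> S) G" by blast
  interpret S: wf_digraph "G \<restriction> S" by auto
  have "symmetric (G \<restriction> S)"
    using graph_symmetric unfolding symmetric_def arcs_ends_induce_subgraph by (auto intro!: symI)
  moreover have "finite S" using S finite_verts finite_subset by blast
  ultimately have "graph (G \<restriction> S)"
    by unfold_locales (use no_loops no_multi_arcs in auto)
  moreover have "arcs_ends (G \<restriction> S) = {(u, v). (u, v) \<in> S \<times> S \<and> u \<noteq> v}"
    using S adj_not_same unfolding arcs_ends_induce_subgraph adj.clique_def by auto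
  ultimately have "K\<^bsub>k\<^esub> (G \<restriction> S)" using S unfolding complete_digraph_def by simp
  then show "\<exists>H. subgraph H G \<and> K\<^bsub>k\<^esub> H \<and> verts H = S" using sub by auto
qed

lemma clique_number_eq: "clique_number G = adj.omega (verts G)"
proof -
  have "(\<exists>H. subgraph H G \<and> K\<^bsub>k\<^esub> H) \<longleftrightarrow> (\<exists>S. S \<subseteq> verts G \<and> adj.clique S \<and> card S = k)" for k
    using complete_subgraph_iff by metis
  then have "{k. \<exists>H. subgraph H G \<and> K\<^bsub>k\<^esub> H} = card ` {S. S \<subseteq> verts G \<and> adj.clique S}" by auto
  then show ?thesis unfolding clique_number_def adj.omega_def by simp
qed

lemma complete_graph_exists: "\<exists>H :: (nat, nat \<times> nat) pre_digraph. K\<^bsub>k\<^esub> H \<and> verts H = {..<k}"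
proof -
  have "K\<^bsub>k\<^esub> (with_proj \<lparr>pverts = {..<k}, parcs = {(u, v). (u, v) \<in> {..<k} \<times> {..<k} \<and> u \<noteq> v}\<rparr>)"
    by (simp add: complete_digraph_pair_def)
  then show ?thesis by (intro exI conjI) auto
qed

lemma complete_minor_iff:
  "(\<exists>H :: (nat, nat \<times> nat) pre_digraph. K\<^bsub>k\<^esub> H \<and> is_minor H G) \<longleftrightarrow>
    (\<exists>F. F \<subseteq> Pow (verts G) \<and> adj.kmodel F \<and> card F = k)"
proof
  assume "\<exists>H :: (nat, nat \<times> nat) pre_digraph. K\<^bsub>k\<^esub> H \<and> is_minor H G"
  then obtain H :: "(nat, nat \<times> nat) pre_digraph" where K: "K\<^bsub>k\<^esub> H" and "is_minor H G" by blast
  from this(2) obtain B where B':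
    "\<forall>x\<in>verts H. B x \<subseteq> verts G \<and> adj.conn (B x)"
    "\<forall>x\<in>verts H. \<forall>y\<in>verts H. x \<noteq> y \<longrightarrow> B x \<inter> B y = {}"
    "\<forall>x y. x \<rightarrow>\<^bsub>H\<^esub> y \<longrightarrow> (\<exists>u\<in>B x. \<exists>v\<in>B y. u \<rightarrow>\<^bsub>G\<^esub> v)"
    unfolding is_minor_def connected_induce_iff by (elim exE conjE)
  have k: "card (verts H) = k" and H: "arcs_ends H = {(u, v). (u, v) \<in> verts H \<times> verts H \<and> u \<noteq> v}"
    using K unfolding complete_digraph_def by auto
  have B: "\<And>x. x \<in> verts H \<Longrightarrow> B x \<subseteq> verts G \<and> adj.conn (B x)"
    "\<And>x y. x \<in> verts H \<Longrightarrow> y \<in> verts H \<Longrightarrow> x \<noteq> y \<Longrightarrow> B x \<inter> B y = {}"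
    "\<And>x y. x \<rightarrow>\<^bsub>H\<^esub> y \<Longrightarrow> \<exists>u\<in>B x. \<exists>v\<in>B y. u \<rightarrow>\<^bsub>G\<^esub> v"
    using B' by simp_all
  have ne: "B x \<noteq> {}" if "x \<in> verts H" for x using B(1)[OF that] unfolding adj.conn_def by blast
  \<comment> \<open>Equal branch sets of distinct vertices would be disjoint from themselves, hence
    empty.\<close>
  have "inj_on B (verts H)"
  proof (rule inj_onI)
    fix x y assume xy: "x \<in> verts H" "y \<in> verts H" "B x = B y"
    then show "x = y" using B(2)[of x y] ne[of x] by auto
  qed
  then have "card (B ` verts H) = k" using k by (simp add: card_image)
  moreover have "adj.kmodel (B ` verts H)"
    unfolding adj.kmodel_def
  proof (intro conjI ballI impI; (elim imageE)?)
    fix C x assume "C = B x" "x \<in> verts H"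
    then show "adj.conn C" using B(1) by simp
  next
    fix C D x y assume xy: "C = B x" "x \<in> verts H" "D = B y" "y \<in> verts H" "C \<noteq> D"
    then have ne: "x \<noteq> y" by blast
    then show "C \<inter> D = {}" using B(2) xy by simp
    have "x \<rightarrow>\<^bsub>H\<^esub> y" using xy ne H by simp
    then show "adj.touch C D" using B(3) xy unfolding adj.touch_def by simp
  qed
  moreover have "B ` verts H \<subseteq> Pow (verts G)" using B(1) by blast
  ultimately show "\<exists>F. F \<subseteq> Pow (verts G) \<and> adj.kmodel F \<and> card F = k" by blast
next
  assume "\<exists>F. F \<subseteq> Pow (verts G) \<and> adj.kmodel F \<and> card F = k"
  then obtain F where F: "F \<subseteq> Pow (verts G)" "adj.kmodel F" "card F = k" by blast
  have "finite F" using F(1) finite_verts by (meson finite_Pow_iff finite_subset)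
  \<comment> \<open>Any enumeration of \<open>F\<close> will do, since every two members
    touch.\<close>
  then obtain B where B: "bij_betw B {..<k} F"
    using F(3) ex_bij_betw_nat_finite[of F] by (auto simp: atLeast0LessThan)
  then have mem: "B x \<in> F" if "x < k" for x using that by (auto simp: bij_betw_def)
  have inj: "B x \<noteq> B y" if "x < k" "y < k" "x \<noteq> y" for x y
    using B that by (auto simp: bij_betw_def inj_on_def)
  obtain H :: "(nat, nat \<times> nat) pre_digraph" where H: "K\<^bsub>k\<^esub> H" "verts H = {..<k}"
    using complete_graph_exists by blast
  have "is_minor H G"
    unfolding is_minor_def connected_induce_iff
  proof (intro exI[of _ B] conjI ballI allI impI)
    fix x assume "x \<in> verts H"
    then show "B x \<subseteq> verts G" "adj.conn (B x)" using mem F H(2) unfolding adj.kmodel_def by auto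
  next
    fix x y assume "x \<in> verts H" "y \<in> verts H" "x \<noteq> y"
    then show "B x \<inter> B y = {}" using mem inj F(2) H(2) unfolding adj.kmodel_def by simp
  next
    fix x y assume "x \<rightarrow>\<^bsub>H\<^esub> y"
    then have "x < k" "y < k" "x \<noteq> y" using H unfolding complete_digraph_def by auto
    then have "adj.touch (B x) (B y)" using mem inj F(2) unfolding adj.kmodel_def by simp
    then show "\<exists>u\<in>B x. \<exists>v\<in>B y. u \<rightarrow>\<^bsub>G\<^esub> v" unfolding adj.touch_def .
  qed
  then show "\<exists>H :: (nat, nat \<times> nat) pre_digraph. K\<^bsub>k\<^esub> H \<and> is_minor H G" using H by blast
qed

lemma hadwiger_number_eq: "hadwiger_number G = adj.had (verts G)"
proof -
  have "{k. \<exists>H :: (nat, nat \<times> nat) pre_digraph. K\<^bsub>k\<^esub> H \<and> is_minor H G} =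
      card ` {F. F \<subseteq> Pow (verts G) \<and> adj.kmodel F}"
    unfolding complete_minor_iff by auto
  then show ?thesis unfolding hadwiger_number_def adj.had_def by simp
qed

lemma ex_perfect_matching_iff: "(\<exists>M. perfect_matching G M) \<longleftrightarrow> adj.matched (verts G)"
proof
  assume "\<exists>M. perfect_matching G M"
  then obtain M where "perfect_matching G M" by blast
  then have M: "M \<subseteq> uedges G" "\<And>v. v \<in> verts G \<Longrightarrow> \<exists>!e. e \<in> M \<and> v \<in> e"
    unfolding perfect_matching_def by simp_all
  have e: "\<exists>u v. e = {u, v} \<and> u \<rightarrow>\<^bsub>G\<^esub> v" if "e \<in> M" for e using M(1) that unfolding uedges_def by blast
  then have sub: "e \<subseteq> verts G" if "e \<in> M" for e using that adj_in_verts by force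
  have "disjoint M"
  proof (rule disjointI)
    fix e f assume ef: "e \<in> M" "f \<in> M" "e \<noteq> f"
    have False if "v \<in> e" "v \<in> f" for v
    proof -
      have "v \<in> verts G" using sub ef(1) that(1) by blast
      then show False using M(2)[of v] ef that by metis
    qed
    then show "e \<inter> f = {}" by blast
  qed
  moreover have "\<Union>M = verts G" using sub M(2) by (metis (no_types, lifting) Sup_upper Union_iff subsetD subsetI subset_antisym)
  ultimately show "adj.matched (verts G)" unfolding adj.matched_def using e by (intro exI[of _ M]) blast
next
  assume "adj.matched (verts G)"
  then obtain M where M: "\<forall>e\<in>M. \<exists>u v. e = {u, v} \<and> u \<rightarrow>\<^bsub>G\<^esub> v" "disjoint M" "\<Union>M = verts G"
    unfolding adj.matched_def by blast
  have "M \<subseteq> uedges G" using M(1) unfolding uedges_def by blast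
  moreover have "\<forall>v\<in>verts G. \<exists>!e. e \<in> M \<and> v \<in> e"
  proof
    fix v assume "v \<in> verts G"
    then obtain e where e: "e \<in> M" "v \<in> e" using M(3) by blast
    show "\<exists>!e. e \<in> M \<and> v \<in> e"
    proof (rule ex1I[of _ e])
      fix f assume "f \<in> M \<and> v \<in> f"
      then show "f = e" using disjointD[OF M(2), of f e] e by blast
    qed (use e in simp)
  qed
  ultimately show "\<exists>M. perfect_matching G M" unfolding perfect_matching_def by (intro exI[of _ M] conjI)
qed

lemma awalk_verts_successively:
  "cas u es v \<Longrightarrow> set es \<subseteq> arcs G \<Longrightarrow> successively (\<lambda>u v. u \<rightarrow>\<^bsub>G\<^esub> v) (awalk_verts u es)"
proof (induction es arbitrary: u)
  case (Cons e es)
  then have "tail G e \<rightarrow>\<^bsub>G\<^esub> head G e" by (auto simp: arcs_ends_conv)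
  moreover have "hd (awalk_verts (head G e) es) = head G e" using Cons.prems by (cases es) auto
  ultimately show ?case using Cons by (simp add: successively_Cons)
qed simp

lemma awalk_of_successively:
  assumes "successively (\<lambda>u v. u \<rightarrow>\<^bsub>G\<^esub> v) (u # p)" "u \<in> verts G"
  shows "\<exists>es. awalk u es (last (u # p)) \<and> awalk_verts u es = u # p"
  using assms
proof (induction p arbitrary: u)
  case Nil
  then show ?case by (intro exI[of _ "[]"]) (simp add: awalk_Nil_iff)
next
  case (Cons x p)
  then have "u \<rightarrow>\<^bsub>G\<^esub> x" "successively (\<lambda>u v. u \<rightarrow>\<^bsub>G\<^esub> v) (x # p)" by auto
  moreover from this obtain e where e: "e \<in> arcs G" "tail G e = u" "head G e = x" by blast
  moreover have "x \<in> verts G" using e head_in_verts by blast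
  ultimately obtain es where "awalk x es (last (x # p))" "awalk_verts x es = x # p"
    using Cons.IH by blast
  then show ?case using e Cons.prems
    by (intro exI[of _ "e # es"]) (auto simp: awalk_Cons_iff)
qed

lemma undirected_forest_iff: "undirected_forest G \<longleftrightarrow> adj.had (verts G) \<le> 2"
proof -
  have "(\<exists>p. cycle p \<and> 3 \<le> length p) \<longleftrightarrow> 3 \<le> adj.had (verts G)"
  proof
    assume "\<exists>p. cycle p \<and> 3 \<le> length p"
    then obtain es u where es: "awalk u es u" "distinct (tl (awalk_verts u es))" "3 \<le> length es"
      unfolding cycle_def by blast
    \<comment> \<open>The list starts and ends at \<open>u\<close>, so its tail names each vertex of
      the cycle once.\<close>
    define vs where "vs = awalk_verts u es"
    have cas: "cas u es u" "set es \<subseteq> arcs G" using es(1) unfolding awalk_def by auto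
    have succ: "successively (\<lambda>u v. u \<rightarrow>\<^bsub>G\<^esub> v) vs" unfolding vs_def by (rule awalk_verts_successively[OF cas])
    have hl: "hd vs = u" "last vs = u" using es(1) unfolding vs_def by auto
    have len: "length vs = Suc (length es)" unfolding vs_def by (rule length_awalk_verts)
    then have vs: "vs = u # tl vs" "tl vs \<noteq> []" using hl(1) es(3) by (cases vs; auto)+
    then have "last (tl vs) = u" "u \<rightarrow>\<^bsub>G\<^esub> hd (tl vs)" "successively (\<lambda>u v. u \<rightarrow>\<^bsub>G\<^esub> v) (tl vs)"
      using hl(2) succ by (metis last_ConsR, metis successively_Cons, metis successively_Cons)
    moreover have "set vs \<subseteq> verts G" unfolding vs_def using es(1) awalk_verts_in_verts
      by (metis awalkE')
    then have "set (tl vs) \<subseteq> verts G" using set_subset_Cons[of "tl vs" u] vs(1) by simp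
    ultimately show "3 \<le> adj.had (verts G)"
      using es(2,3) len by (intro adj.had3_of_cycle[of _ "tl vs"]) (auto simp: vs_def)
  next
    assume "3 \<le> adj.had (verts G)"
    then obtain p where p: "set p \<subseteq> verts G" "distinct p" "3 \<le> length p"
      "successively (\<lambda>u v. u \<rightarrow>\<^bsub>G\<^esub> v) p" "last p \<rightarrow>\<^bsub>G\<^esub> hd p"
      using adj.cycle_of_had3 finite_verts by blast
    then obtain u q where uq: "p = u # q" by (cases p) auto
    \<comment> \<open>A second \<open>u\<close> at the end turns the cyclic sequence into a closed
      walk with as many arcs as \<open>p\<close> has vertices.\<close>
    have "successively (\<lambda>u v. u \<rightarrow>\<^bsub>G\<^esub> v) (u # q @ [u])"
      using p(4,5) uq successively_append_iff[of "\<lambda>u v. u \<rightarrow>\<^bsub>G\<^esub> v" "u # q" "[u]"] by simp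
    moreover have "u \<in> verts G" using p(1) uq by simp
    ultimately obtain es where es: "awalk u es u" "awalk_verts u es = u # q @ [u]"
      using awalk_of_successively[of u "q @ [u]"] by auto
    have "length es = length p" using length_awalk_verts[of u es] es(2) uq by simp
    then have "cycle es" "3 \<le> length es"
      using es p uq unfolding cycle_def by (auto intro!: exI[of _ u])
    then show "\<exists>p. cycle p \<and> 3 \<le> length p" by blast
  qed
  then show ?thesis unfolding undirected_forest_def by auto
qed

end

theorem theorem3:
  fixes G :: "('a, 'b) pre_digraph"
    and n \<omega> \<alpha> h :: nat
  assumes "graph G"
    and "arcs G \<noteq> {}"
    and "\<exists>u\<in>verts G. \<exists>v\<in>verts G. u \<noteq> v \<and> \<not> u \<rightarrow>\<^bsub>G\<^esub> v"
    and "n = card (verts G)"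
    and "\<omega> = clique_number G"
    and "\<alpha> = independence_number G"
    and "h = hadwiger_number G"
  shows "(2 * int \<alpha> - 1) * (int h - 1) + 3 \<ge> int n + int \<omega> \<and>
    ((2 * int \<alpha> - 1) * (int h - 1) + 3 = int n + int \<omega> \<longleftrightarrow>
      (arcs G \<noteq> {} \<and> undirected_forest G \<and> (\<exists>M. perfect_matching G M)) \<or>
      (even n \<and>
       (\<exists>H1 H2. subgraph H1 G \<and> subgraph H2 G \<and> K\<^bsub>n div 2\<^esub> H1 \<and> K\<^bsub>n div 2\<^esub> H2 \<and>
          verts H1 \<inter> verts H2 = {} \<and> verts H1 \<union> verts H2 = verts G) \<and>
       h = n div 2))"
proof -
  interpret graph G by fact
  interpret adj: adjacency "\<lambda>u v. u \<rightarrow>\<^bsub>G\<^esub> v" by (rule adjacency_arcs)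
  let ?V = "verts G"
  have fin: "finite ?V" by simp
  have om: "\<omega> = adj.omega ?V" and al: "\<alpha> = adj.alpha ?V" and h: "h = adj.had ?V"
    using assms(5-7) clique_number_eq independence_number_eq hadwiger_number_eq by simp_all
  obtain e where "e \<in> arcs G" using assms(2) by blast
  then have "tail G e \<rightarrow>\<^bsub>G\<^esub> head G e" by (auto simp: arcs_ends_conv)
  then have ni: "\<not> adj.indep ?V" using tail_in_verts[OF \<open>e \<in> arcs G\<close>] head_in_verts[OF \<open>e \<in> arcs G\<close>]
    unfolding adj.indep_def by blast
  have nc: "\<not> adj.clique ?V" using assms(3) unfolding adj.clique_def by blast
  have w2: "2 \<le> \<omega>" using adj.not_indep_omega[OF fin ni] om by simp
  have a2: "2 \<le> \<alpha>" using adj.alpha_ge2[OF fin nc] al by simp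
  have wh: "\<omega> \<le> h" using adj.omega_le_had[OF fin] om h by simp
  have le: "int n + int \<omega> \<le> (2 * int \<alpha> - 1) * (int h - 1) + 3"
    and ext: "int n + int \<omega> = (2 * int \<alpha> - 1) * (int h - 1) + 3 \<Longrightarrow> adj.extremal ?V"
    using adj.bounded_finite[OF fin] ni nc unfolding adj.bounded_def adj.bound_def om al h assms(4) by auto
  let ?i = "undirected_forest G \<and> (\<exists>M. perfect_matching G M)"
  let ?ii = "even n \<and>
       (\<exists>H1 H2. subgraph H1 G \<and> subgraph H2 G \<and> K\<^bsub>n div 2\<^esub> H1 \<and> K\<^bsub>n div 2\<^esub> H2 \<and>
          verts H1 \<inter> verts H2 = {} \<and> verts H1 \<union> verts H2 = verts G) \<and>
       h = n div 2"
  \<comment> \<open>An edge forces h \<ge> \<omega> \<ge> 2, so for a forest h is exactly 2.\<close>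
  have i: "?i \<longleftrightarrow> h = 2 \<and> adj.matched ?V"
    using undirected_forest_iff ex_perfect_matching_iff h w2 wh by auto
  have ii: "?ii \<longleftrightarrow> n = 2 * h \<and> (\<exists>A B. ?V = A \<union> B \<and> A \<inter> B = {} \<and> adj.clique A \<and> adj.clique B \<and>
      card A = h \<and> card B = h)" (is "_ \<longleftrightarrow> _ \<and> ?AB")
  proof
    assume ?ii
    then obtain H1 H2 where n: "n = 2 * h" and
      H: "subgraph H1 G" "subgraph H2 G" "K\<^bsub>h\<^esub> H1" "K\<^bsub>h\<^esub> H2"
        "verts H1 \<inter> verts H2 = {}" "verts H1 \<union> verts H2 = verts G" by auto
    have "adj.clique (verts H1) \<and> card (verts H1) = h" "adj.clique (verts H2) \<and> card (verts H2) = h"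
      using complete_subgraph_iff H(1-4) by blast+
    then show "n = 2 * h \<and> ?AB" using n H(5,6) by blast
  next
    assume "n = 2 * h \<and> ?AB"
    then obtain A B where n: "n = 2 * h" and AB: "?V = A \<union> B" "A \<inter> B = {}"
      "adj.clique A" "adj.clique B" "card A = h" "card B = h" by blast
    then obtain H1 H2 where "subgraph H1 G" "subgraph H2 G" "K\<^bsub>h\<^esub> H1" "K\<^bsub>h\<^esub> H2" "verts H1 = A" "verts H2 = B"
      using complete_subgraph_iff[of h A] complete_subgraph_iff[of h B] by blast
    then show ?ii using n AB by auto
  qed
  have fwd: "?i \<or> ?ii" if "int n + int \<omega> = (2 * int \<alpha> - 1) * (int h - 1) + 3"
    using ext[OF that] unfolding adj.extremal_def h[symmetric]
  proof (elim disjE conjE)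
    assume "h = 2" "adj.matched ?V"
    then show ?thesis unfolding i by blast
  next
    assume AB: "\<exists>A B. ?V = A \<union> B \<and> A \<inter> B = {} \<and> adj.clique A \<and> adj.clique B \<and> card A = h \<and> card B = h"
    then obtain A B where "?V = A \<union> B" "A \<inter> B = {}" "card A = h" "card B = h" by blast
    moreover from this have "finite A" "finite B" using fin by auto
    ultimately have "n = 2 * h" using assms(4) by (simp add: card_Un_disjoint)
    then show ?thesis unfolding ii using AB by blast
  qed
  have bwd: "int n + int \<omega> = (2 * int \<alpha> - 1) * (int h - 1) + 3" if "?i \<or> ?ii"
    using that
  proof
    assume ?i
    then have "h = 2" "2 * \<alpha> \<le> n" using i adj.matched_alpha[OF fin] al assms(4) by auto
    then show ?thesis using le w2 wh by simp
  next
    assume ?ii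
    then obtain A B where n: "n = 2 * h" and AB: "?V = A \<union> B" "adj.clique A" "adj.clique B" "card A = h"
      unfolding ii by blast
    then have "finite A" "finite B" using fin by auto
    \<comment> \<open>With \<alpha> = 2, \<omega> = h and n = 2h both sides equal 3h.\<close>
    then have "\<alpha> = 2" using adj.alpha_two_cliques AB al a2 by force
    moreover have "\<omega> = h" using adj.omega_ge[OF fin _ AB(2)] AB om wh by auto
    ultimately show ?thesis using n by simp
  qed
  have iff: "(2 * int \<alpha> - 1) * (int h - 1) + 3 = int n + int \<omega> \<longleftrightarrow> ?i \<or> ?ii"
    by (rule iffI) (erule fwd[OF sym], erule bwd[THEN sym])
  show ?thesis
    unfolding iff using le assms(2) by (simp only: simp_thms)
qed


end
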